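(* If $\mathfrak{d} = \aleph_1$, then there exists a maximal $3$-ladder of cardinality $\aleph_1$.
   Context: A poset is lower finite if for each element $p$ the set $\{q : q \le p\}$ is finite. In a poset, $q$ is a lower cover of $p$ if $q < p$ and there is no $x$ with $q < x < p$. For a positive integer $n$, an $n$-ladder is a lower finite lattice in which every element has at most $n$ lower covers. An ideal of a poset is a nonempty subset that is downward closed and upward directed; it is proper if it is not the whole poset. An $n$-ladder is maximal if it is not isomorphic to a proper ideal of an $n$-ladder. For $f, g \in {}^\omega\omega$, $g$ dominates $f$ (written $f <^* g$) if $f(k) < g(k)$ for all but finitely many $k \in \omega$. A family $\mathcal{D} \subseteq {}^\omega\omega$ is dominating if every element of ${}^\omega\omega$ is dominated by some element of $\mathcal{D}$. The dominating number $\mathfrak{d}$ is the smallest cardinality of a dominating family. *)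

theory Defs
  imports "HOL-Algebra.Lattice"
begin

unbundle cardinal_syntax

definition lower_finite :: "'a gorder \<Rightarrow> bool"
  where "lower_finite L \<longleftrightarrow> (\<forall>p\<in>carrier L. finite {q \<in> carrier L. q \<sqsubseteq>\<^bsub>L\<^esub> p})"

definition lower_covers :: "'a gorder \<Rightarrow> 'a \<Rightarrow> 'a set"
  where "lower_covers L p =
    {q \<in> carrier L. q \<sqsubset>\<^bsub>L\<^esub> p \<and> \<not> (\<exists>x\<in>carrier L. q \<sqsubset>\<^bsub>L\<^esub> x \<and> x \<sqsubset>\<^bsub>L\<^esub> p)}"

text \<open>Sets of lower covers are finite by lower finiteness, so \<^const>\<open>card\<close> is their true cardinality.\<close>

definition ladder :: "nat \<Rightarrow> 'a gorder \<Rightarrow> bool"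
  where "ladder n L \<longleftrightarrow>
    lattice L \<and> lower_finite L \<and> (\<forall>p\<in>carrier L. card (lower_covers L p) \<le> n)"

definition order_ideal :: "'a gorder \<Rightarrow> 'a set \<Rightarrow> bool"
  where "order_ideal L I \<longleftrightarrow>
    I \<subseteq> carrier L \<and> I \<noteq> {} \<and>
    (\<forall>x\<in>I. \<forall>y\<in>carrier L. y \<sqsubseteq>\<^bsub>L\<^esub> x \<longrightarrow> y \<in> I) \<and>
    (\<forall>x\<in>I. \<forall>y\<in>I. \<exists>z\<in>I. x \<sqsubseteq>\<^bsub>L\<^esub> z \<and> y \<sqsubseteq>\<^bsub>L\<^esub> z)"

definition proper_order_ideal :: "'a gorder \<Rightarrow> 'a set \<Rightarrow> bool"
  where "proper_order_ideal L I \<longleftrightarrow> order_ideal L I \<and> I \<noteq> carrier L"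

definition order_isomorphic :: "'a gorder \<Rightarrow> 'b gorder \<Rightarrow> bool"
  where "order_isomorphic A B \<longleftrightarrow>
    (\<exists>f. order_emb A B f \<and> bij_betw f (carrier A) (carrier B))"

text \<open>
  HOL cannot quantify over ladders on carriers of every type inside a definition, so
  maximality refers to ladders carried by subsets of the type \<^typ>\<open>'a + nat\<close>.
  This is no restriction: by \<open>maximal_ladder_iff\<close> below, the property is equivalent to
  the one with any other type of cardinality at least that of \<^typ>\<open>'a + nat\<close>, and
  a maximal ladder is not isomorphic to a proper ideal of a ladder on any type whatsoever.
\<close>

definition maximal_ladder :: "nat \<Rightarrow> 'a gorder \<Rightarrow> bool"
  where "maximal_ladder n P \<longleftrightarrow> ladder n P \<and>
    \<not> (\<exists>(L :: ('a + nat) gorder) I.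
         ladder n L \<and> proper_order_ideal L I \<and> order_isomorphic P (L\<lparr>carrier := I\<rparr>))"

definition dominates :: "(nat \<Rightarrow> nat) \<Rightarrow> (nat \<Rightarrow> nat) \<Rightarrow> bool"
  where "dominates g f \<longleftrightarrow> (\<forall>\<^sub>\<infinity>k. f k < g k)"

definition dominating :: "(nat \<Rightarrow> nat) set \<Rightarrow> bool"
  where "dominating D \<longleftrightarrow> (\<forall>f. \<exists>g\<in>D. dominates g f)"

definition dominating_number :: "(nat \<Rightarrow> nat) rel"
  where "dominating_number = |SOME D. dominating D \<and> (\<forall>E. dominating E \<longrightarrow> |D| \<le>o |E| )|"

abbreviation aleph1 :: "nat set rel"
  where "aleph1 \<equiv> cardSuc natLeq"

lemma dominating_number_least:
  shows "\<exists>D. dominating D \<and> dominating_number = |D|"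
    and "dominating E \<Longrightarrow> dominating_number \<le>o |E|"
proof -
  have "dominates (\<lambda>k. Suc (f k)) f" for f
    by (simp add: dominates_def)
  then have "dominating UNIV"
    unfolding dominating_def by blast
  then have "card_of ` Collect dominating \<noteq> {}" by blast
  moreover have "\<forall>r\<in>card_of ` Collect dominating. Card_order r"
    by (rule ballI, elim imageE, simp only: card_of_Card_order)
  ultimately obtain D where "dominating D" "\<forall>E. dominating E \<longrightarrow> |D| \<le>o |E|"
    using exists_minim_Card_order[of "card_of ` Collect dominating"] by blast
  then have *: "\<exists>D. dominating D \<and> (\<forall>E. dominating E \<longrightarrow> |D| \<le>o |E| )" by blast
  show "\<exists>D. dominating D \<and> dominating_number = |D|"
    using someI_ex[OF *] unfolding dominating_number_def by blast
  show "dominating E \<Longrightarrow> dominating_number \<le>o |E|"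
    using someI_ex[OF *] unfolding dominating_number_def by blast
qed

lemma order_emb_simp:
  "order_emb A B f \<longleftrightarrow> weak_partial_order A \<and> weak_partial_order B \<and>
     (\<forall>x\<in>carrier A. \<forall>y\<in>carrier A. f x \<sqsubseteq>\<^bsub>B\<^esub> f y \<longleftrightarrow> x \<sqsubseteq>\<^bsub>A\<^esub> y)"
  unfolding order_emb_def by auto

lemma lattice_iff:
  "lattice L \<longleftrightarrow> partial_order L \<and>
    (\<forall>x\<in>carrier L. \<forall>y\<in>carrier L. \<exists>s\<in>carrier L. x \<sqsubseteq>\<^bsub>L\<^esub> s \<and> y \<sqsubseteq>\<^bsub>L\<^esub> s \<and>
       (\<forall>u\<in>carrier L. x \<sqsubseteq>\<^bsub>L\<^esub> u \<and> y \<sqsubseteq>\<^bsub>L\<^esub> u \<longrightarrow> s \<sqsubseteq>\<^bsub>L\<^esub> u)) \<and>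
    (\<forall>x\<in>carrier L. \<forall>y\<in>carrier L. \<exists>s\<in>carrier L. s \<sqsubseteq>\<^bsub>L\<^esub> x \<and> s \<sqsubseteq>\<^bsub>L\<^esub> y \<and>
       (\<forall>u\<in>carrier L. u \<sqsubseteq>\<^bsub>L\<^esub> x \<and> u \<sqsubseteq>\<^bsub>L\<^esub> y \<longrightarrow> u \<sqsubseteq>\<^bsub>L\<^esub> s))"
  (is "_ \<longleftrightarrow> _ \<and> ?S \<and> ?I")
proof -
  have up: "least L s (Upper L {x, y}) \<longleftrightarrow> s\<in>carrier L \<and> x \<sqsubseteq>\<^bsub>L\<^esub> s \<and> y \<sqsubseteq>\<^bsub>L\<^esub> s \<and>
       (\<forall>u\<in>carrier L. x \<sqsubseteq>\<^bsub>L\<^esub> u \<and> y \<sqsubseteq>\<^bsub>L\<^esub> u \<longrightarrow> s \<sqsubseteq>\<^bsub>L\<^esub> u)"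
    if "x \<in> carrier L" "y \<in> carrier L" for x y s
    using that unfolding least_def Upper_def by auto
  have lo: "greatest L s (Lower L {x, y}) \<longleftrightarrow> s\<in>carrier L \<and> s \<sqsubseteq>\<^bsub>L\<^esub> x \<and> s \<sqsubseteq>\<^bsub>L\<^esub> y \<and>
       (\<forall>u\<in>carrier L. u \<sqsubseteq>\<^bsub>L\<^esub> x \<and> u \<sqsubseteq>\<^bsub>L\<^esub> y \<longrightarrow> u \<sqsubseteq>\<^bsub>L\<^esub> s)"
    if "x \<in> carrier L" "y \<in> carrier L" for x y s
    using that unfolding greatest_def Lower_def by auto
  have "lattice L \<longleftrightarrow> partial_order L \<and>
     (\<forall>x\<in>carrier L. \<forall>y\<in>carrier L. \<exists>s. least L s (Upper L {x, y})) \<and>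
     (\<forall>x\<in>carrier L. \<forall>y\<in>carrier L. \<exists>s. greatest L s (Lower L {x, y}))"
    unfolding lattice_def upper_semilattice_def lower_semilattice_def
      upper_semilattice_axioms_def lower_semilattice_axioms_def by blast
  moreover have "(\<forall>x\<in>carrier L. \<forall>y\<in>carrier L. \<exists>s. least L s (Upper L {x, y})) \<longleftrightarrow> ?S"
    by (simp add: up Bex_def)
  moreover have "(\<forall>x\<in>carrier L. \<forall>y\<in>carrier L. \<exists>s. greatest L s (Lower L {x, y})) \<longleftrightarrow> ?I"
    by (simp add: lo Bex_def)
  ultimately show ?thesis by simp
qed

lemma partial_order_iff:
  "partial_order L \<longleftrightarrow> eq L = (=) \<and> (\<forall>x\<in>carrier L. x \<sqsubseteq>\<^bsub>L\<^esub> x) \<and>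
    (\<forall>x\<in>carrier L. \<forall>y\<in>carrier L. x \<sqsubseteq>\<^bsub>L\<^esub> y \<and> y \<sqsubseteq>\<^bsub>L\<^esub> x \<longrightarrow> x = y) \<and>
    (\<forall>x\<in>carrier L. \<forall>y\<in>carrier L. \<forall>z\<in>carrier L. x \<sqsubseteq>\<^bsub>L\<^esub> y \<and> y \<sqsubseteq>\<^bsub>L\<^esub> z \<longrightarrow> x \<sqsubseteq>\<^bsub>L\<^esub> z)"
  (is "_ \<longleftrightarrow> ?R")
proof
  assume "partial_order L"
  then interpret partial_order L .
  show ?R
    using eq_is_equal le_refl le_antisym le_trans by blast
next
  assume R: ?R
  then have eq: "eq L = (=)" by blast
  show "partial_order L"
  proof
    show "x \<sqsubseteq>\<^bsub>L\<^esub> z" if "x \<sqsubseteq>\<^bsub>L\<^esub> y" "y \<sqsubseteq>\<^bsub>L\<^esub> z" "x \<in> carrier L" "y \<in> carrier L" "z \<in> carrier L"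
      for x y z using R that by blast
    show "x .=\<^bsub>L\<^esub> y" if "x \<sqsubseteq>\<^bsub>L\<^esub> y" "y \<sqsubseteq>\<^bsub>L\<^esub> x" "x \<in> carrier L" "y \<in> carrier L" for x y
      using R that unfolding eq by blast
    show "x \<sqsubseteq>\<^bsub>L\<^esub> x" if "x \<in> carrier L" for x using R that by blast
  qed (simp_all add: eq)
qed

lemma ladder_transport:
  assumes L: "ladder n L" and f: "bij_betw f (carrier L) (carrier M)"
    and le: "\<And>x y. x \<in> carrier L \<Longrightarrow> y \<in> carrier L \<Longrightarrow> f x \<sqsubseteq>\<^bsub>M\<^esub> f y \<longleftrightarrow> x \<sqsubseteq>\<^bsub>L\<^esub> y"
    and eq: "eq M = (=)"
  shows "ladder n M"
proof -
  have C: "carrier M = f ` carrier L" and inj: "inj_on f (carrier L)"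
    using f by (auto simp: bij_betw_def)
  have PL: "partial_order L" using L by (simp add: ladder_def lattice_iff)
  have eqL: "eq L = (=)" using PL by (simp add: partial_order_iff)
  have feq: "f x = f y \<longleftrightarrow> x = y" if "x \<in> carrier L" "y \<in> carrier L" for x y
    using inj that by (auto dest: inj_onD)
  have lt: "f x \<sqsubset>\<^bsub>M\<^esub> f y \<longleftrightarrow> x \<sqsubset>\<^bsub>L\<^esub> y" if "x \<in> carrier L" "y \<in> carrier L" for x y
    using that by (simp add: lless_def eq eqL le feq)
  have PM: "partial_order M"
    unfolding partial_order_iff C ball_simps
  proof (intro conjI ballI impI)
    show "eq M = (=)" by (rule eq)
    show "f x \<sqsubseteq>\<^bsub>M\<^esub> f x" if "x \<in> carrier L" for x
      using PL that by (simp add: le partial_order_iff)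
    show "f x = f y" if "x \<in> carrier L" "y \<in> carrier L" "f x \<sqsubseteq>\<^bsub>M\<^esub> f y \<and> f y \<sqsubseteq>\<^bsub>M\<^esub> f x" for x y
    proof -
      have "x \<sqsubseteq>\<^bsub>L\<^esub> y \<and> y \<sqsubseteq>\<^bsub>L\<^esub> x" using that le by blast
      with that(1,2) PL have "x = y" unfolding partial_order_iff by blast
      then show ?thesis by simp
    qed
    show "f x \<sqsubseteq>\<^bsub>M\<^esub> f z" if c: "x \<in> carrier L" "y \<in> carrier L" "z \<in> carrier L"
      and "f x \<sqsubseteq>\<^bsub>M\<^esub> f y \<and> f y \<sqsubseteq>\<^bsub>M\<^esub> f z" for x y z
    proof -
      have "x \<sqsubseteq>\<^bsub>L\<^esub> y \<and> y \<sqsubseteq>\<^bsub>L\<^esub> z" using that le by blast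
      with c PL have "x \<sqsubseteq>\<^bsub>L\<^esub> z" unfolding partial_order_iff by blast
      then show ?thesis using c le by blast
    qed
  qed
  have lat: "lattice M"
    using L PM unfolding ladder_def lattice_iff
    by (simp add: C le cong: ball_cong bex_cong)
  have "finite {q \<in> carrier M. q \<sqsubseteq>\<^bsub>M\<^esub> f p}" if "p \<in> carrier L" for p
  proof -
    have "{q \<in> carrier M. q \<sqsubseteq>\<^bsub>M\<^esub> f p} = f ` {q \<in> carrier L. q \<sqsubseteq>\<^bsub>L\<^esub> p}"
      using that by (auto simp: C le)
    then show ?thesis using L that by (simp add: ladder_def lower_finite_def)
  qed
  then have fin: "lower_finite M" by (simp add: lower_finite_def C)
  have "card (lower_covers M (f p)) \<le> n" if "p \<in> carrier L" for p
  proof -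
    have "lower_covers M (f p) = f ` lower_covers L p"
      using that by (auto simp: lower_covers_def C lt)
    moreover have "inj_on f (lower_covers L p)"
      using inj by (rule inj_on_subset) (auto simp: lower_covers_def)
    ultimately show ?thesis using L that by (simp add: ladder_def card_image)
  qed
  with lat fin show ?thesis by (simp add: ladder_def C)
qed

lemma ladder_ideal:
  assumes L: "ladder n L" and I: "order_ideal L I"
  shows "ladder n (L\<lparr>carrier := I\<rparr>)"
proof -
  have PL: "partial_order L" using L by (simp add: ladder_def lattice_iff)
  interpret partial_order L by (rule PL)
  have sub: "I \<subseteq> carrier L" and down: "\<And>x y. x \<in> I \<Longrightarrow> y \<in> carrier L \<Longrightarrow> y \<sqsubseteq>\<^bsub>L\<^esub> x \<Longrightarrow> y \<in> I"
    and dir: "\<And>x y. x \<in> I \<Longrightarrow> y \<in> I \<Longrightarrow> \<exists>z\<in>I. x \<sqsubseteq>\<^bsub>L\<^esub> z \<and> y \<sqsubseteq>\<^bsub>L\<^esub> z"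
    using I by (auto simp: order_ideal_def)
  let ?M = "L\<lparr>carrier := I\<rparr>"
  have PM: "partial_order ?M"
    unfolding partial_order_iff
  proof (intro conjI ballI impI)
    show "eq ?M = (=)" using eq_is_equal by simp
    show "x \<sqsubseteq>\<^bsub>?M\<^esub> x" if "x \<in> carrier ?M" for x
      using sub that by auto
    show "x = y" if "x \<in> carrier ?M" "y \<in> carrier ?M" "x \<sqsubseteq>\<^bsub>?M\<^esub> y \<and> y \<sqsubseteq>\<^bsub>?M\<^esub> x" for x y
      using sub that by (auto intro: le_antisym)
    show "x \<sqsubseteq>\<^bsub>?M\<^esub> z" if "x \<in> carrier ?M" "y \<in> carrier ?M" "z \<in> carrier ?M"
      "x \<sqsubseteq>\<^bsub>?M\<^esub> y \<and> y \<sqsubseteq>\<^bsub>?M\<^esub> z" for x y z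
      using sub that le_trans[of x y z] by auto
  qed
  have "\<exists>s\<in>I. x \<sqsubseteq>\<^bsub>L\<^esub> s \<and> y \<sqsubseteq>\<^bsub>L\<^esub> s \<and> (\<forall>u\<in>I. x \<sqsubseteq>\<^bsub>L\<^esub> u \<and> y \<sqsubseteq>\<^bsub>L\<^esub> u \<longrightarrow> s \<sqsubseteq>\<^bsub>L\<^esub> u)"
    if xy: "x \<in> I" "y \<in> I" for x y
  proof -
    have "x \<in> carrier L" "y \<in> carrier L" using xy sub by auto
    then obtain s where s: "s\<in>carrier L" "x \<sqsubseteq>\<^bsub>L\<^esub> s" "y \<sqsubseteq>\<^bsub>L\<^esub> s"
      "\<forall>u\<in>carrier L. x \<sqsubseteq>\<^bsub>L\<^esub> u \<and> y \<sqsubseteq>\<^bsub>L\<^esub> u \<longrightarrow> s \<sqsubseteq>\<^bsub>L\<^esub> u"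
      using L unfolding ladder_def lattice_iff by blast
    then show ?thesis using dir[OF xy] down sub by (meson subsetD)
  qed
  moreover have "\<exists>s\<in>I. s \<sqsubseteq>\<^bsub>L\<^esub> x \<and> s \<sqsubseteq>\<^bsub>L\<^esub> y \<and> (\<forall>u\<in>I. u \<sqsubseteq>\<^bsub>L\<^esub> x \<and> u \<sqsubseteq>\<^bsub>L\<^esub> y \<longrightarrow> u \<sqsubseteq>\<^bsub>L\<^esub> s)"
    if xy: "x \<in> I" "y \<in> I" for x y
  proof -
    have "x \<in> carrier L" "y \<in> carrier L" using xy sub by auto
    then obtain s where s: "s\<in>carrier L" "s \<sqsubseteq>\<^bsub>L\<^esub> x" "s \<sqsubseteq>\<^bsub>L\<^esub> y"
      "\<forall>u\<in>carrier L. u \<sqsubseteq>\<^bsub>L\<^esub> x \<and> u \<sqsubseteq>\<^bsub>L\<^esub> y \<longrightarrow> u \<sqsubseteq>\<^bsub>L\<^esub> s"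
      using L unfolding ladder_def lattice_iff by blast
    then show ?thesis using xy down sub by (meson subsetD)
  qed
  ultimately have lat: "lattice ?M"
    using PM unfolding lattice_iff by simp
  have fin: "lower_finite ?M"
    unfolding lower_finite_def
  proof
    fix p assume "p \<in> carrier ?M"
    then have "finite {q \<in> carrier L. q \<sqsubseteq>\<^bsub>L\<^esub> p}"
      using L sub by (auto simp: ladder_def lower_finite_def)
    then show "finite {q \<in> carrier ?M. q \<sqsubseteq>\<^bsub>?M\<^esub> p}"
      by (rule rev_finite_subset) (use sub in auto)
  qed
  have "lower_covers ?M p = lower_covers L p" if "p \<in> I" for p
    using that sub down by (auto simp: lower_covers_def lless_def)
  then show ?thesis using lat fin L sub by (auto simp: ladder_def)
qed

lemma small_extension:
  fixes P :: "'a gorder" and L :: "'b gorder"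
  assumes L: "ladder n L" and I: "proper_order_ideal L I"
    and iso: "order_isomorphic P (L\<lparr>carrier := I\<rparr>)"
    and c: "|UNIV :: ('a + nat) set| \<le>o |UNIV :: 'c set|"
  shows "\<exists>(M :: 'c gorder) K.
    ladder n M \<and> proper_order_ideal M K \<and> order_isomorphic P (M\<lparr>carrier := K\<rparr>)"
proof -
  have PL: "partial_order L" using L by (simp add: ladder_def lattice_iff)
  interpret partial_order L by (rule PL)
  have sub: "I \<subseteq> carrier L" and ne: "I \<noteq> {}"
    and down: "\<And>x y. x \<in> I \<Longrightarrow> y \<in> carrier L \<Longrightarrow> y \<sqsubseteq>\<^bsub>L\<^esub> x \<Longrightarrow> y \<in> I"
    and dir: "\<And>x y. x \<in> I \<Longrightarrow> y \<in> I \<Longrightarrow> \<exists>z\<in>I. x \<sqsubseteq>\<^bsub>L\<^esub> z \<and> y \<sqsubseteq>\<^bsub>L\<^esub> z"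
    and nc: "I \<noteq> carrier L"
    using I by (auto simp: order_ideal_def proper_order_ideal_def)
  obtain x where x: "x \<in> carrier L" "x \<notin> I" using sub nc by blast
  have "\<forall>i\<in>I. \<exists>s\<in>carrier L. i \<sqsubseteq>\<^bsub>L\<^esub> s \<and> x \<sqsubseteq>\<^bsub>L\<^esub> s \<and>
      (\<forall>u\<in>carrier L. i \<sqsubseteq>\<^bsub>L\<^esub> u \<and> x \<sqsubseteq>\<^bsub>L\<^esub> u \<longrightarrow> s \<sqsubseteq>\<^bsub>L\<^esub> u)"
  proof
    fix i assume "i \<in> I"
    then have i: "i \<in> carrier L" using sub by blast
    have "\<forall>a\<in>carrier L. \<forall>b\<in>carrier L. \<exists>s\<in>carrier L. a \<sqsubseteq>\<^bsub>L\<^esub> s \<and> b \<sqsubseteq>\<^bsub>L\<^esub> s \<and>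
       (\<forall>u\<in>carrier L. a \<sqsubseteq>\<^bsub>L\<^esub> u \<and> b \<sqsubseteq>\<^bsub>L\<^esub> u \<longrightarrow> s \<sqsubseteq>\<^bsub>L\<^esub> u)"
      using L unfolding ladder_def lattice_iff by (elim conjE)
    from bspec[OF bspec[OF this i] x(1)]
    show "\<exists>s\<in>carrier L. i \<sqsubseteq>\<^bsub>L\<^esub> s \<and> x \<sqsubseteq>\<^bsub>L\<^esub> s \<and>
      (\<forall>u\<in>carrier L. i \<sqsubseteq>\<^bsub>L\<^esub> u \<and> x \<sqsubseteq>\<^bsub>L\<^esub> u \<longrightarrow> s \<sqsubseteq>\<^bsub>L\<^esub> u)" .
  qed
  then obtain j where j: "\<And>i. i \<in> I \<Longrightarrow> j i \<in> carrier L" "\<And>i. i \<in> I \<Longrightarrow> i \<sqsubseteq>\<^bsub>L\<^esub> j i"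
    "\<And>i. i \<in> I \<Longrightarrow> x \<sqsubseteq>\<^bsub>L\<^esub> j i"
    and jl: "\<And>i u. i \<in> I \<Longrightarrow> u \<in> carrier L \<Longrightarrow> i \<sqsubseteq>\<^bsub>L\<^esub> u \<Longrightarrow> x \<sqsubseteq>\<^bsub>L\<^esub> u \<Longrightarrow> j i \<sqsubseteq>\<^bsub>L\<^esub> u"
    by metis
  define J where "J = (\<Union>i\<in>I. {y \<in> carrier L. y \<sqsubseteq>\<^bsub>L\<^esub> j i})"
  have Jsub: "J \<subseteq> carrier L" by (auto simp: J_def)
  have IJ: "I \<subseteq> J" using sub j by (auto simp: J_def)
  have xJ: "x \<in> J" using ne x j by (auto simp: J_def)
  have Jid: "order_ideal L J"
    unfolding order_ideal_def
  proof (intro conjI ballI impI)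
    show "J \<subseteq> carrier L" by (rule Jsub)
    show "J \<noteq> {}" using xJ by blast
  next
    fix a b assume "a \<in> J" and b: "b \<in> carrier L" "b \<sqsubseteq>\<^bsub>L\<^esub> a"
    then obtain i where i: "i \<in> I" "a \<in> carrier L" "a \<sqsubseteq>\<^bsub>L\<^esub> j i" by (auto simp: J_def)
    then have "b \<sqsubseteq>\<^bsub>L\<^esub> j i" using le_trans[OF b(2) i(3)] b j(1) by auto
    then show "b \<in> J" using i b by (auto simp: J_def)
  next
    fix a b assume "a \<in> J" "b \<in> J"
    then obtain i i' where i: "i \<in> I" "i' \<in> I" "a \<sqsubseteq>\<^bsub>L\<^esub> j i" "b \<sqsubseteq>\<^bsub>L\<^esub> j i'" 
      and ab: "a \<in> carrier L" "b \<in> carrier L" by (auto simp: J_def)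
    obtain k where k: "k \<in> I" "i \<sqsubseteq>\<^bsub>L\<^esub> k" "i' \<sqsubseteq>\<^bsub>L\<^esub> k" using dir i by blast
    have car: "i \<in> carrier L" "i' \<in> carrier L" "k \<in> carrier L" using i k sub by auto
    have "i \<sqsubseteq>\<^bsub>L\<^esub> j k" "i' \<sqsubseteq>\<^bsub>L\<^esub> j k" 
      using le_trans[OF k(2) j(2)[OF k(1)]] le_trans[OF k(3) j(2)[OF k(1)]] car j(1)[OF k(1)] by auto
    then have "j i \<sqsubseteq>\<^bsub>L\<^esub> j k" "j i' \<sqsubseteq>\<^bsub>L\<^esub> j k"
      using jl i j k by auto
    then have "a \<sqsubseteq>\<^bsub>L\<^esub> j k" "b \<sqsubseteq>\<^bsub>L\<^esub> j k" 
      using le_trans[OF i(3)] le_trans[OF i(4)] ab j(1) i k by auto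
    moreover have "j k \<in> J" using j(1) k(1) le_refl unfolding J_def by blast
    ultimately show "\<exists>z\<in>J. a \<sqsubseteq>\<^bsub>L\<^esub> z \<and> b \<sqsubseteq>\<^bsub>L\<^esub> z" by blast
  qed
  have lad: "ladder n (L\<lparr>carrier := J\<rparr>)" using ladder_ideal[OF L Jid] .
  obtain f where fe: "order_emb P (L\<lparr>carrier := I\<rparr>) f" and fb: "bij_betw f (carrier P) I"
    using iso by (auto simp: order_isomorphic_def)
  have "|I| \<le>o |UNIV :: 'a set|"
    using fb by (metis bij_betw_inv card_of_ordIsoI card_of_mono1 ordIso_ordLeq_trans subset_UNIV)
  moreover have "|UNIV :: 'a set| \<le>o |UNIV :: ('a + nat) set|"
    using card_of_ordLeq[of "UNIV :: 'a set" "UNIV :: ('a + nat) set"] inj_Inl by blast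
  ultimately have "|I| \<le>o |UNIV :: ('a + nat) set|" by (rule ordLeq_transitive)
  moreover have inf: "\<not> finite (UNIV :: ('a + nat) set)" by (simp add: finite_Plus_UNIV_iff)
  moreover have "\<forall>i\<in>I. |{y \<in> carrier L. y \<sqsubseteq>\<^bsub>L\<^esub> j i}| \<le>o |UNIV :: ('a + nat) set|"
  proof
    fix i assume "i \<in> I"
    then have fin: "finite {y \<in> carrier L. y \<sqsubseteq>\<^bsub>L\<^esub> j i}"
      using L j(1) by (simp add: ladder_def lower_finite_def)
    show "|{y \<in> carrier L. y \<sqsubseteq>\<^bsub>L\<^esub> j i}| \<le>o |UNIV :: ('a + nat) set|"
      by (rule ordLess_imp_ordLeq, rule finite_ordLess_infinite[OF card_of_Well_order card_of_Well_order])
        (simp_all only: Field_card_of fin inf not_False_eq_True)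
  qed
  ultimately have "|J| \<le>o |UNIV :: ('a + nat) set|"
    unfolding J_def by (intro card_of_UNION_ordLeq_infinite) auto
  then have "|J| \<le>o |UNIV :: 'c set|" using c by (rule ordLeq_transitive)
  then obtain g :: "'b \<Rightarrow> 'c" where g: "inj_on g J"
    using card_of_ordLeq[of J "UNIV :: 'c set"] by blast
  define M :: "'c gorder" where "M = \<lparr>carrier = g ` J, eq = (=),
    le = (\<lambda>a b. inv_into J g a \<sqsubseteq>\<^bsub>L\<^esub> inv_into J g b)\<rparr>"
  have Mle: "g a \<sqsubseteq>\<^bsub>M\<^esub> g b \<longleftrightarrow> a \<sqsubseteq>\<^bsub>L\<^esub> b" if "a \<in> J" "b \<in> J" for a b
    using that g by (simp add: M_def)
  have MC: "carrier M = g ` J" and Meq: "eq M = (=)" by (simp_all add: M_def)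
  have Mlad: "ladder n M"
    by (rule ladder_transport[OF lad, of g]) (use g Mle MC Meq in \<open>auto simp: bij_betw_def\<close>)
  have Kid: "proper_order_ideal M (g ` I)"
    unfolding proper_order_ideal_def order_ideal_def
  proof (intro conjI)
    show "g ` I \<subseteq> carrier M" "g ` I \<noteq> {}" using IJ ne MC by auto
    show "\<forall>a\<in>g ` I. \<forall>b\<in>carrier M. b \<sqsubseteq>\<^bsub>M\<^esub> a \<longrightarrow> b \<in> g ` I"
      unfolding MC ball_simps
    proof (intro ballI impI)
      fix a b assume *: "a \<in> I" "b \<in> J" "g b \<sqsubseteq>\<^bsub>M\<^esub> g a"
      then have "b \<sqsubseteq>\<^bsub>L\<^esub> a" using Mle[of b a] IJ by blast
      then show "g b \<in> g ` I" using down[of a b] * Jsub by blast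
    qed
    show "\<forall>a\<in>g ` I. \<forall>b\<in>g ` I. \<exists>z\<in>g ` I. a \<sqsubseteq>\<^bsub>M\<^esub> z \<and> b \<sqsubseteq>\<^bsub>M\<^esub> z"
      unfolding ball_simps bex_simps
    proof (intro ballI)
      fix a b assume *: "a \<in> I" "b \<in> I"
      then obtain z where "z \<in> I" "a \<sqsubseteq>\<^bsub>L\<^esub> z" "b \<sqsubseteq>\<^bsub>L\<^esub> z" using dir by blast
      then show "\<exists>z\<in>I. g a \<sqsubseteq>\<^bsub>M\<^esub> g z \<and> g b \<sqsubseteq>\<^bsub>M\<^esub> g z"
        using * IJ Mle by blast
    qed
    show "g ` I \<noteq> carrier M"
      using inj_on_image_eq_iff[OF g IJ subset_refl] xJ x unfolding MC by blast
  qed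
  have Kpo: "partial_order (M\<lparr>carrier := g ` I\<rparr>)"
    using ladder_ideal[OF Mlad] Kid by (simp add: proper_order_ideal_def ladder_def lattice_iff)
  have "order_emb P (M\<lparr>carrier := g ` I\<rparr>) (g \<circ> f)"
    using fe fb IJ Kpo
    by (auto simp: order_emb_simp partial_order_def Mle subset_iff bij_betw_def)
  moreover have "bij_betw (g \<circ> f) (carrier P) (g ` I)"
    using fb g IJ by (metis bij_betw_trans inj_on_imp_bij_betw inj_on_subset)
  ultimately have "order_isomorphic P (M\<lparr>carrier := g ` I\<rparr>)"
    by (auto simp: order_isomorphic_def)
  with Mlad Kid show ?thesis by blast
qed

theorem maximal_ladder_imp:
  fixes P :: "'a gorder" and L :: "'b gorder"
  assumes "maximal_ladder n P" "ladder n L" "proper_order_ideal L I"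
  shows "\<not> order_isomorphic P (L\<lparr>carrier := I\<rparr>)"
proof
  assume iso: "order_isomorphic P (L\<lparr>carrier := I\<rparr>)"
  have "|UNIV :: ('a + nat) set| \<le>o |UNIV :: ('a + nat) set|"
    by (rule ordLeq_reflexive[OF card_of_Well_order])
  from small_extension[OF assms(2,3) iso this] assms(1) show False
    unfolding maximal_ladder_def by (elim conjE notE)
qed

theorem maximal_ladder_iff:
  fixes P :: "'a gorder"
  assumes "|UNIV :: ('a + nat) set| \<le>o |UNIV :: 'c set|"
  shows "maximal_ladder n P \<longleftrightarrow> ladder n P \<and>
    \<not> (\<exists>(L :: 'c gorder) I.
         ladder n L \<and> proper_order_ideal L I \<and> order_isomorphic P (L\<lparr>carrier := I\<rparr>))"
    (is "_ \<longleftrightarrow> _ \<and> \<not> ?E")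
proof
  assume P: "maximal_ladder n P"
  then have "ladder n P" by (simp add: maximal_ladder_def)
  moreover have "\<not> ?E" using maximal_ladder_imp[OF P] by blast
  ultimately show "ladder n P \<and> \<not> ?E" by (rule conjI)
next
  assume P: "ladder n P \<and> \<not> ?E"
  show "maximal_ladder n P"
    unfolding maximal_ladder_def
  proof (intro conjI notI)
    show "ladder n P" using P by (rule conjunct1)
    assume "\<exists>(L :: ('a + nat) gorder) I.
      ladder n L \<and> proper_order_ideal L I \<and> order_isomorphic P (L\<lparr>carrier := I\<rparr>)"
    then obtain L :: "('a + nat) gorder" and I
      where "ladder n L" "proper_order_ideal L I" "order_isomorphic P (L\<lparr>carrier := I\<rparr>)"
      by (elim exE conjE)
    from small_extension[OF this assms] P show False by (elim conjE notE)
  qed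
qed

end

theory Submission
  imports Defs "HOL-Library.Countable_Set_Type"
begin

text \<open>
  Extending a ladder loses a dimension. Let \<open>I\<close> be an ideal of an \<open>(n+1)\<close>-ladder \<open>L\<close> and let
  \<open>c\<close> be an element of \<open>L\<close> outside \<open>I\<close>. Every \<open>y \<ge> c\<close> has a greatest element of \<open>I\<close> below it,
  its shadow. The set of all shadows is an \<open>n\<close>-ladder that is cofinal in \<open>I\<close>, since each of its
  elements \<open>d\<close> gives up one lower cover: \<open>c \<squnion> d\<close> has a lower cover above \<open>d\<close> that is not above
  \<open>c\<close> (lemma \<open>ladder_descent\<close>).

  Suppose that a \<open>3\<close>-ladder \<open>P\<close> of size \<open>\<aleph>\<^sub>1\<close> is a proper ideal of a \<open>3\<close>-ladder. One descent
  gives a cofinal \<open>2\<close>-ladder \<open>C\<close> in \<open>P\<close> such that every element of \<open>P\<close> has a least element of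
  \<open>C\<close> above it, its closure. As \<open>C\<close> is uncountable, every countable ideal \<open>J\<close> of \<open>C\<close> is proper, and a
  second descent gives a cofinal chain \<open>D\<close> in \<open>J\<close> that contains the shadows in \<open>J\<close> of all
  elements of \<open>C\<close> above some \<open>c\<close>. The following \<open>P\<close> is designed
  so that no such chain exists.

  It consists of triples \<open>(n, \<alpha>, m)\<close> with \<open>\<alpha> < \<omega>\<^sub>1\<close> and \<open>g \<alpha> n \<le> m\<close>. The order
  between the countable ordinals in the middle is controlled by finite sets \<open>S \<alpha> m \<subseteq> {\<xi>. \<xi> \<le> \<alpha>}\<close>
  that increase with \<open>m\<close> and exhaust \<open>{\<xi>. \<xi> \<le> \<alpha>}\<close>: a triple \<open>(n, \<alpha>, l)\<close> is below
  \<open>(k, \<beta>, m)\<close> if \<open>n \<le> k\<close>, \<open>l \<le> m\<close> and \<open>\<alpha> \<in> S \<beta> m\<close>. The sets cohere, that is, \<open>S \<xi> m\<close> is an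
  initial segment of \<open>S \<alpha> m\<close> whenever \<open>\<xi> \<in> S \<alpha> m\<close>, so the relations \<open>\<xi> \<in> S \<alpha> m\<close> are tree
  orders in which every element has only finitely many predecessors; without the bound given by
  \<open>g\<close> one has the product of the chain \<open>\<omega>\<close> with a \<open>2\<close>-ladder. The bound makes the ladder maximal. If \<open>J\<close> contains the
  closures of all triples at the least ordinal, then an element \<open>(n, \<alpha>, m)\<close> of \<open>C\<close> above \<open>c\<close> and
  its shadow have the same coordinates \<open>n\<close> and \<open>m\<close>. These pairs come from the cofinal chain
  \<open>D\<close>, hence satisfy \<open>m \<le> f n\<close> for a fixed \<open>f\<close>. But if \<open>(n, \<alpha>, m)\<close> lies above a triple at
  \<open>\<beta>\<close>, then \<open>g \<beta> n \<le> m\<close>. So \<open>P\<close> is maximal as soon as the functions \<open>g \<beta>\<close> form a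
  dominating family (lemma \<open>no_proper_extension\<close>).

  The hypothesis \<open>\<dd> = \<aleph>\<^sub>1\<close> lets a dominating family, well-ordered in type
  \<open>\<omega>\<^sub>1\<close>, serve as its own index set. Each \<open>\<alpha>\<close> then has only countably many predecessors, and
  \<open>S \<alpha>\<close> and \<open>g \<alpha>\<close> can be constructed by recursion with \<open>\<alpha> \<le> g \<alpha>\<close> (lemma
  \<open>coherent_system_exists\<close>).
\<close>

section \<open>Ladders, closure systems and ideals\<close>

lemma finite_subset_bounded:
  assumes "finite F" "F \<noteq> {}" "F \<subseteq> S"
    and dir: "\<And>x y. x \<in> S \<Longrightarrow> y \<in> S \<Longrightarrow> \<exists>z\<in>S. R x z \<and> R y z"
    and trans: "\<And>x y z. x \<in> S \<Longrightarrow> y \<in> S \<Longrightarrow> z \<in> S \<Longrightarrow> R x y \<Longrightarrow> R y z \<Longrightarrow> R x z"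
  shows "\<exists>z\<in>S. \<forall>x\<in>F. R x z"
  using assms(1-3)
proof (induction F rule: finite_ne_induct)
  case (singleton x)
  then show ?case using dir[of x x] by auto
next
  case (insert x F)
  then obtain z where z: "z \<in> S" "\<forall>y\<in>F. R y z" by auto
  obtain w where w: "w \<in> S" "R x w" "R z w" using dir[of x z] z insert.prems by auto
  have "R y w" if "y \<in> F" for y
    using trans[of y z w] z w insert.prems that by auto
  then show ?case using w by auto
qed

lemma partial_order_subset:
  fixes L (structure)
  assumes po: "partial_order L" and D: "D \<subseteq> carrier L"
  shows "partial_order (L\<lparr>carrier := D\<rparr>)"
proof -
  interpret partial_order L by (rule po)
  let ?M = "L\<lparr>carrier := D\<rparr>"
  show ?thesis
    unfolding partial_order_iff
  proof (intro conjI ballI impI)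
    show "eq ?M = (=)" using eq_is_equal by simp
    show "x \<sqsubseteq>\<^bsub>?M\<^esub> x" if "x \<in> carrier ?M" for x
      using D that by auto
    show "x = y" if "x \<in> carrier ?M" "y \<in> carrier ?M" "x \<sqsubseteq>\<^bsub>?M\<^esub> y \<and> y \<sqsubseteq>\<^bsub>?M\<^esub> x" for x y
      using D that le_antisym[of x y] by auto
    show "x \<sqsubseteq>\<^bsub>?M\<^esub> z" if "x \<in> carrier ?M" "y \<in> carrier ?M" "z \<in> carrier ?M"
      "x \<sqsubseteq>\<^bsub>?M\<^esub> y \<and> y \<sqsubseteq>\<^bsub>?M\<^esub> z" for x y z
      using D that le_trans[of x y z] by auto
  qed
qed

lemma lower_finite_subset:
  assumes fin: "lower_finite L" and D: "D \<subseteq> carrier L"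
  shows "lower_finite (L\<lparr>carrier := D\<rparr>)"
  unfolding lower_finite_def
proof
  fix p assume "p \<in> carrier (L\<lparr>carrier := D\<rparr>)"
  then have "finite {q \<in> carrier L. q \<sqsubseteq>\<^bsub>L\<^esub> p}"
    using fin D by (auto simp: lower_finite_def)
  then show "finite {q \<in> carrier (L\<lparr>carrier := D\<rparr>). q \<sqsubseteq>\<^bsub>L\<lparr>carrier := D\<rparr>\<^esub> p}"
    by (rule rev_finite_subset) (use D in auto)
qed

text \<open>
  Two elements have an upper bound \<open>u\<close>, and lower finiteness leaves only finitely many upper bounds
  below \<open>u\<close>; the meet of these is the join.
\<close>

lemma lattice_of_meets:
  fixes L (structure)
  assumes po: "partial_order L" and fin: "lower_finite L"
    and dir: "\<And>x y. x \<in> carrier L \<Longrightarrow> y \<in> carrier L \<Longrightarrow> \<exists>z\<in>carrier L. x \<sqsubseteq> z \<and> y \<sqsubseteq> z"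
    and meet: "\<And>x y. x \<in> carrier L \<Longrightarrow> y \<in> carrier L \<Longrightarrow>
      \<exists>s\<in>carrier L. s \<sqsubseteq> x \<and> s \<sqsubseteq> y \<and> (\<forall>u\<in>carrier L. u \<sqsubseteq> x \<and> u \<sqsubseteq> y \<longrightarrow> u \<sqsubseteq> s)"
  shows "lattice L"
  unfolding lattice_iff
proof (intro conjI ballI po)
  interpret partial_order L by (rule po)
  fix x y assume xy: "x \<in> carrier L" "y \<in> carrier L"
  show "\<exists>s\<in>carrier L. s \<sqsubseteq> x \<and> s \<sqsubseteq> y \<and> (\<forall>u\<in>carrier L. u \<sqsubseteq> x \<and> u \<sqsubseteq> y \<longrightarrow> u \<sqsubseteq> s)"
    using meet xy by blast
  let ?U = "{s \<in> carrier L. x \<sqsubseteq> s \<and> y \<sqsubseteq> s}"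
  obtain u where u: "u \<in> carrier L" "x \<sqsubseteq> u" "y \<sqsubseteq> u" using dir xy by blast
  let ?F = "{s \<in> ?U. s \<sqsubseteq> u}"
  have down: "\<exists>s\<in>?U. s \<sqsubseteq> a \<and> s \<sqsubseteq> b" if "a \<in> ?U" "b \<in> ?U" for a b
    using meet[of a b] that xy by blast
  have "finite ?F"
    using fin u(1) unfolding lower_finite_def by (auto elim!: rev_finite_subset ballE[of _ _ u])
  moreover have "?F \<noteq> {}" using u by blast
  ultimately have "\<exists>s\<in>?U. \<forall>t\<in>?F. s \<sqsubseteq> t"
  proof (rule finite_subset_bounded[where R = "\<lambda>a b. b \<sqsubseteq> a"])
    show "\<And>a b c. a \<in> ?U \<Longrightarrow> b \<in> ?U \<Longrightarrow> c \<in> ?U \<Longrightarrow> b \<sqsubseteq> a \<Longrightarrow> c \<sqsubseteq> b \<Longrightarrow> c \<sqsubseteq> a"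
      by (rule le_trans) auto
  qed (use down in auto)
  then obtain s where s: "s \<in> ?U" "\<forall>t\<in>?F. s \<sqsubseteq> t" by blast
  have "s \<sqsubseteq> w" if w: "w \<in> ?U" for w
  proof -
    obtain t where t: "t \<in> ?U" "t \<sqsubseteq> w" "t \<sqsubseteq> u" using down[OF w, of u] u by blast
    then have "s \<sqsubseteq> t" using s by blast
    then show ?thesis using le_trans[of s t w] s t w by blast
  qed
  then show "\<exists>s\<in>carrier L. x \<sqsubseteq> s \<and> y \<sqsubseteq> s \<and> (\<forall>u\<in>carrier L. x \<sqsubseteq> u \<and> y \<sqsubseteq> u \<longrightarrow> s \<sqsubseteq> u)"
    using s by blast
qed

lemma lower_cover_above:
  fixes L (structure)
  assumes "partial_order L" "lower_finite L"
    and xy: "x \<in> carrier L" "y \<in> carrier L" "x \<sqsubseteq> y" "x \<noteq> y"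
  shows "\<exists>z\<in>lower_covers L y. x \<sqsubseteq> z"
proof -
  interpret partial_order L by fact
  have ls: "a \<sqsubset> b \<longleftrightarrow> a \<sqsubseteq> b \<and> a \<noteq> b" for a b
    by (simp add: lless_def eq_is_equal)
  let ?S = "{z \<in> carrier L. x \<sqsubseteq> z \<and> z \<sqsubset> y}"
  let ?R = "\<lambda>a b. a \<in> ?S \<and> b \<in> ?S \<and> b \<sqsubset> a"
  have fin: "finite ?S"
    using \<open>lower_finite L\<close> xy(2) unfolding lower_finite_def ls
    by (auto elim!: rev_finite_subset ballE[of _ _ y])
  have tr: "a \<sqsubset> c" if "a \<in> ?S" "b \<in> ?S" "c \<in> ?S" "a \<sqsubset> b" "b \<sqsubset> c" for a b c
    using that le_trans[of a b c] le_antisym[of b c] unfolding ls by blast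
  have ne: "?S \<noteq> {}" using xy by (auto simp: ls)
  have "transp_on ?S (\<lambda>a b. a \<sqsubset> b)" by (rule transp_onI) (use tr in blast)
  moreover have "asymp_on ?S (\<lambda>a b. a \<sqsubset> b)"
    by (rule asymp_onI) (auto simp: ls dest: le_antisym)
  ultimately have "\<exists>z\<in>?S. \<forall>b\<in>?S. b \<noteq> z \<longrightarrow> \<not> z \<sqsubset> b"
    using Finite_Set.bex_max_element[OF fin _ _ ne] by blast
  then obtain z where z: "z \<in> ?S" "\<forall>b\<in>?S. \<not> z \<sqsubset> b" by (auto simp: ls)
  have "z \<in> lower_covers L y"
    unfolding lower_covers_def
  proof (intro CollectI conjI notI)
    assume "\<exists>w\<in>carrier L. z \<sqsubset> w \<and> w \<sqsubset> y"
    then obtain w where w: "w \<in> carrier L" "z \<sqsubset> w" "w \<sqsubset> y" by blast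
    then have "x \<sqsubseteq> w" using le_trans[of x z w] z xy by (auto simp: ls)
    then show False using w z by blast
  qed (use z in auto)
  then show ?thesis using z by blast
qed

text \<open>
  The join of two incomparable elements has a lower cover above each of them, and these two lower
  covers differ.
\<close>

lemma ladder_1_chain:
  fixes L (structure)
  assumes L: "ladder 1 L" and xy: "x \<in> carrier L" "y \<in> carrier L"
  shows "x \<sqsubseteq> y \<or> y \<sqsubseteq> x"
proof (rule ccontr)
  assume inc: "\<not> ?thesis"
  interpret lattice L using L by (simp add: ladder_def)
  have po: "partial_order L" and fin: "lower_finite L"
    using L by (simp_all add: ladder_def lattice_iff)
  let ?j = "x \<squnion> y"
  have j: "?j \<in> carrier L" "x \<sqsubseteq> ?j" "y \<sqsubseteq> ?j" using xy by (auto intro: join_left join_right)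
  then have "x \<noteq> ?j" "y \<noteq> ?j" using inc by auto
  then obtain a b where ab: "a \<in> lower_covers L ?j" "x \<sqsubseteq> a" "b \<in> lower_covers L ?j" "y \<sqsubseteq> b"
    using lower_cover_above[OF po fin] xy j by meson
  have "finite (lower_covers L ?j)"
    using fin j unfolding lower_finite_def lower_covers_def lless_def
    by (auto elim!: rev_finite_subset ballE[of _ _ ?j])
  moreover have "card (lower_covers L ?j) \<le> Suc 0" using L j by (auto simp: ladder_def)
  ultimately have "a = b" using ab by (auto simp: card_le_Suc0_iff_eq)
  moreover have a: "a \<in> carrier L" "a \<sqsubseteq> ?j" "a \<noteq> ?j"
    using ab(1) by (auto simp: lower_covers_def lless_def eq_is_equal)
  ultimately have "?j \<sqsubseteq> a" using join_le ab xy by blast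
  then show False using a j le_antisym by blast
qed

text \<open>
  The ideal is generated by the joins of the initial segments of an enumeration; each of these
  countably many joins has only finitely many elements below it.
\<close>

lemma countable_order_ideal:
  fixes L (structure)
  assumes L: "ladder n L" and S: "S \<subseteq> carrier L" "S \<noteq> {}" "countable S"
  obtains I where "order_ideal L I" "countable I" "S \<subseteq> I"
proof -
  interpret lattice L using L by (simp add: ladder_def)
  define s where "s = from_nat_into S"
  have s: "s k \<in> carrier L" for k using S from_nat_into[of S k] by (auto simp: s_def)
  have sS: "S = range s" using S by (simp add: s_def range_from_nat_into)
  define t where "t = rec_nat (s 0) (\<lambda>k x. x \<squnion> s (Suc k))"
  have t_simps: "t 0 = s 0" "\<And>k. t (Suc k) = t k \<squnion> s (Suc k)" by (simp_all add: t_def)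
  have t: "t k \<in> carrier L" for k by (induction k) (simp_all add: t_simps s)
  have st: "s k \<sqsubseteq> t k" for k
    by (cases k) (simp_all add: t_simps s t join_right)
  have tmono: "t i \<sqsubseteq> t j" if "i \<le> j" for i j
    using that
  proof (induction rule: dec_induct)
    case (step k)
    have "t k \<sqsubseteq> t (Suc k)" by (simp add: t_simps join_left s t)
    then show ?case using le_trans[OF step.IH _ t t t] by blast
  qed (simp add: t)
  define I where "I = (\<Union>k. {x \<in> carrier L. x \<sqsubseteq> t k})"
  show thesis
  proof
    have "finite {x \<in> carrier L. x \<sqsubseteq> t k}" for k
      using L t by (simp add: ladder_def lower_finite_def)
    then show "countable I" unfolding I_def by (auto intro: countable_finite)
    show "S \<subseteq> I" using s st by (auto simp: sS I_def)
    show "order_ideal L I"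
      unfolding order_ideal_def
    proof (intro conjI ballI impI)
      show "I \<subseteq> carrier L" "I \<noteq> {}" using \<open>S \<subseteq> I\<close> S by (auto simp: I_def)
      show "y \<in> I" if x: "x \<in> I" and y: "y \<in> carrier L" "y \<sqsubseteq> x" for x y
      proof -
        obtain k where k: "x \<in> carrier L" "x \<sqsubseteq> t k" using x by (auto simp: I_def)
        show ?thesis
          using le_trans[OF y(2) k(2) y(1) k(1) t] y(1) by (auto simp: I_def)
      qed
      fix x y assume "x \<in> I" "y \<in> I"
      then obtain i j where x: "x \<in> carrier L" "x \<sqsubseteq> t i" and y: "y \<in> carrier L" "y \<sqsubseteq> t j"
        by (auto simp: I_def)
      have "x \<sqsubseteq> t (max i j)" "y \<sqsubseteq> t (max i j)"
        by (rule le_trans[OF x(2) tmono x(1) t t], simp, rule le_trans[OF y(2) tmono y(1) t t], simp)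
      moreover have "t (max i j) \<in> I" using le_refl[OF t] t unfolding I_def by blast
      ultimately show "\<exists>z\<in>I. x \<sqsubseteq> z \<and> y \<sqsubseteq> z" by blast
    qed
  qed
qed

text \<open>
  The witness \<open>D\<close> is the set of shadows: the elements \<open>pr y\<close>, for \<open>y \<ge> c\<close>, where \<open>pr y\<close> is the
  greatest element of \<open>I\<close> below \<open>y\<close>. The map \<open>p \<mapsto> pr (c \<squnion> p)\<close> is a closure operator on \<open>I\<close> with
  image \<open>D\<close>, which makes \<open>D\<close> a lattice. Distinct lower covers \<open>e\<close> of \<open>d\<close> in \<open>D\<close> give distinct lower
  covers of \<open>c \<squnion> d\<close> in \<open>L\<close>, because \<open>e\<close> is the shadow of any lower cover of \<open>c \<squnion> d\<close> above
  \<open>c \<squnion> e\<close>. A lower cover of \<open>c \<squnion> d\<close> above \<open>d\<close> is not above \<open>c\<close>, so it is a further one.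
\<close>

theorem ladder_descent:
  fixes L (structure)
  assumes L: "ladder (Suc n) L" and I: "order_ideal L I" and c: "c \<in> carrier L" "c \<notin> I"
  obtains D where "D \<subseteq> I" "ladder n (L\<lparr>carrier := D\<rparr>)"
    "\<And>p. p \<in> I \<Longrightarrow> \<exists>d\<in>D. p \<sqsubseteq> d \<and> (\<forall>e\<in>D. p \<sqsubseteq> e \<longrightarrow> d \<sqsubseteq> e)"
    "\<And>y. y \<in> carrier L \<Longrightarrow> c \<sqsubseteq> y \<Longrightarrow> \<exists>d\<in>D. d \<sqsubseteq> y \<and> (\<forall>p\<in>I. p \<sqsubseteq> y \<longrightarrow> p \<sqsubseteq> d)"
proof -
  interpret lattice L using L by (simp add: ladder_def)
  have po: "partial_order L" and fin: "lower_finite L"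
    using L by (simp_all add: ladder_def lattice_iff)
  have ls: "a \<sqsubset> b \<longleftrightarrow> a \<sqsubseteq> b \<and> a \<noteq> b" for a b
    by (simp add: lless_def eq_is_equal)
  have sub: "I \<subseteq> carrier L" and ne: "I \<noteq> {}"
    and down: "\<And>x y. x \<in> I \<Longrightarrow> y \<in> carrier L \<Longrightarrow> y \<sqsubseteq> x \<Longrightarrow> y \<in> I"
    and dir: "\<And>x y. x \<in> I \<Longrightarrow> y \<in> I \<Longrightarrow> \<exists>z\<in>I. x \<sqsubseteq> z \<and> y \<sqsubseteq> z"
    using I unfolding order_ideal_def by blast+
  have car: "x \<in> carrier L" if "x \<in> I" for x using that sub by blast
  have join_I: "x \<squnion> y \<in> I" if "x \<in> I" "y \<in> I" for x y
    using dir[OF that] down join_le car that by (meson join_closed)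
  have "\<exists>d\<in>I. d \<sqsubseteq> y \<and> (\<forall>p\<in>I. p \<sqsubseteq> y \<longrightarrow> p \<sqsubseteq> d)" if y: "y \<in> carrier L" for y
  proof -
    let ?F = "{p \<in> I. p \<sqsubseteq> y}"
    have "finite ?F"
      using fin y sub unfolding lower_finite_def by (auto elim!: rev_finite_subset ballE[of _ _ y])
    moreover have "?F \<noteq> {}"
    proof -
      obtain i where "i \<in> I" using ne by blast
      then have "i \<sqinter> y \<in> ?F"
        using down[of i "i \<sqinter> y"] car y by (auto intro: meet_left meet_right)
      then show ?thesis by blast
    qed
    ultimately have "\<exists>d\<in>?F. \<forall>p\<in>?F. p \<sqsubseteq> d"
    proof (rule finite_subset_bounded)
      show "\<exists>c\<in>?F. a \<sqsubseteq> c \<and> b \<sqsubseteq> c" if "a \<in> ?F" "b \<in> ?F" for a b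
        using that join_I[of a b] join_le[of a y b] join_left[of a b] join_right[of a b] y car by blast
      show "a \<sqsubseteq> e" if "a \<in> ?F" "b \<in> ?F" "e \<in> ?F" "a \<sqsubseteq> b" "b \<sqsubseteq> e" for a b e
        using le_trans[OF that(4,5)] that(1-3) car by blast
    qed auto
    then show ?thesis by blast
  qed
  then obtain pr where pr: "\<And>y. y \<in> carrier L \<Longrightarrow> pr y \<in> I"
    "\<And>y. y \<in> carrier L \<Longrightarrow> pr y \<sqsubseteq> y"
    and pr_greatest: "\<And>y p. y \<in> carrier L \<Longrightarrow> p \<in> I \<Longrightarrow> p \<sqsubseteq> y \<Longrightarrow> p \<sqsubseteq> pr y"
    by metis
  have prc: "pr y \<in> carrier L" if "y \<in> carrier L" for y using pr car that by blast
  have pr_mono: "pr x \<sqsubseteq> pr y" if "x \<in> carrier L" "y \<in> carrier L" "x \<sqsubseteq> y" for x y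
    using pr_greatest[of y "pr x"] pr[of x] le_trans[of "pr x" x y] that prc by blast
  define D where "D = pr ` {y \<in> carrier L. c \<sqsubseteq> y}"
  let ?D = "L\<lparr>carrier := D\<rparr>"
  have DI: "D \<subseteq> I" using pr by (auto simp: D_def)
  have prD: "pr y \<in> D" if "y \<in> carrier L" "c \<sqsubseteq> y" for y using that by (auto simp: D_def)
  have cj: "c \<squnion> p \<in> carrier L" "c \<sqsubseteq> c \<squnion> p" "p \<sqsubseteq> c \<squnion> p" if "p \<in> I" for p
    using that c car by (auto intro: join_left join_right)
  have clos: "pr (c \<squnion> p) \<in> D" "p \<sqsubseteq> pr (c \<squnion> p)" if "p \<in> I" for p
    using that cj prD pr_greatest by auto
  have clos_least: "pr (c \<squnion> p) \<sqsubseteq> e" if p: "p \<in> I" and "e \<in> D" "p \<sqsubseteq> e" for p e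
  proof -
    obtain y where y: "y \<in> carrier L" "c \<sqsubseteq> y" "e = pr y" using \<open>e \<in> D\<close> by (auto simp: D_def)
    have "p \<sqsubseteq> y" using le_trans[of p e y] y pr[of y] \<open>p \<sqsubseteq> e\<close> prc[of y] car[OF p] by auto
    then have "c \<squnion> p \<sqsubseteq> y" using y join_le c car[OF p] by blast
    then show ?thesis using pr_mono cj(1)[OF p] y by auto
  qed
  have clos_D: "pr (c \<squnion> d) = d" if d: "d \<in> D" for d
  proof -
    have dI: "d \<in> I" using d DI by blast
    show ?thesis
      by (rule le_antisym[OF clos_least[OF dI d le_refl[OF car[OF dI]]] clos(2)[OF dI]
            prc[OF cj(1)[OF dI]] car[OF dI]])
  qed
  have poD: "partial_order ?D"
    using DI sub by (intro partial_order_subset po) blast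
  have finD: "lower_finite ?D"
    using DI sub by (intro lower_finite_subset fin) blast
  have latD: "lattice ?D"
  proof (rule lattice_of_meets[OF poD finD])
    fix x y assume "x \<in> carrier ?D" "y \<in> carrier ?D"
    then have xy: "x \<in> D" "y \<in> D" "x \<in> I" "y \<in> I" "x \<in> carrier L" "y \<in> carrier L"
      using DI car by auto
    have "x \<sqsubseteq> pr (c \<squnion> (x \<squnion> y))" "y \<sqsubseteq> pr (c \<squnion> (x \<squnion> y))"
      using le_trans[OF join_left[OF xy(5,6)] clos(2)[OF join_I[OF xy(3,4)]]]
        le_trans[OF join_right[OF xy(5,6)] clos(2)[OF join_I[OF xy(3,4)]]] xy
        prc[OF cj(1)[OF join_I[OF xy(3,4)]]] by auto
    then show "\<exists>z\<in>carrier ?D. x \<sqsubseteq>\<^bsub>?D\<^esub> z \<and> y \<sqsubseteq>\<^bsub>?D\<^esub> z"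
      using clos(1)[OF join_I[OF xy(3,4)]] by auto
    let ?m = "x \<sqinter> y"
    have m: "?m \<in> carrier L" "?m \<sqsubseteq> x" "?m \<sqsubseteq> y" using xy by (auto intro: meet_left meet_right)
    have mI: "?m \<in> I" using down m xy by blast
    have "pr (c \<squnion> ?m) \<sqsubseteq> ?m"
      using clos_least[OF mI xy(1) m(2)] clos_least[OF mI xy(2) m(3)] meet_le xy
        prc[OF cj(1)[OF mI]] by blast
    then have "pr (c \<squnion> ?m) = ?m"
      using le_antisym[OF _ clos(2)[OF mI] prc[OF cj(1)[OF mI]] m(1)] by blast
    then have "?m \<in> D" using clos(1)[OF mI] by simp
    moreover have "u \<sqsubseteq> ?m" if "u \<in> D" "u \<sqsubseteq> x" "u \<sqsubseteq> y" for u
      using that meet_le[of u x y] xy DI car by blast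
    ultimately show "\<exists>s\<in>carrier ?D. s \<sqsubseteq>\<^bsub>?D\<^esub> x \<and> s \<sqsubseteq>\<^bsub>?D\<^esub> y \<and>
        (\<forall>u\<in>carrier ?D. u \<sqsubseteq>\<^bsub>?D\<^esub> x \<and> u \<sqsubseteq>\<^bsub>?D\<^esub> y \<longrightarrow> u \<sqsubseteq>\<^bsub>?D\<^esub> s)"
      using m by auto
  qed
  have "card (lower_covers ?D d) \<le> n" if dD: "d \<in> D" for d
  proof -
    have d: "d \<in> I" "d \<in> carrier L" using dD DI car by auto
    let ?j = "c \<squnion> d"
    note j = cj[OF d(1)]
    have lt: "e \<in> D \<and> e \<sqsubseteq> d \<and> e \<noteq> d" "e \<in> I" "e \<in> carrier L" if "e \<in> lower_covers ?D d" for e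
      using that DI car by (auto simp: lower_covers_def lless_def eq_is_equal)
    have "\<exists>k\<in>lower_covers L ?j. c \<squnion> e \<sqsubseteq> k" if e: "e \<in> lower_covers ?D d" for e
    proof (rule lower_cover_above[OF po fin _ j(1)])
      note e' = lt[OF e]
      show "c \<squnion> e \<in> carrier L" using cj e' by blast
      show "c \<squnion> e \<sqsubseteq> ?j"
        using join_le[OF j(2) le_trans[OF _ j(3), of e]] e' j(1) c d by auto
      show "c \<squnion> e \<noteq> ?j"
        using clos_D[of e] clos_D[OF dD] e' by force
    qed
    then obtain k where k: "\<And>e. e \<in> lower_covers ?D d \<Longrightarrow> k e \<in> lower_covers L ?j"
      "\<And>e. e \<in> lower_covers ?D d \<Longrightarrow> c \<squnion> e \<sqsubseteq> k e" by metis
    have low: "x \<in> carrier L" "x \<sqsubseteq> ?j" "x \<noteq> ?j" if "x \<in> lower_covers L ?j" for x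
      using that by (auto simp: lower_covers_def ls)
    have ck: "c \<sqsubseteq> k e" "e \<sqsubseteq> k e" if e: "e \<in> lower_covers ?D d" for e
      using le_trans[OF cj(2) k(2)[OF e]] le_trans[OF cj(3) k(2)[OF e]] lt[OF e] cj c
        low(1)[OF k(1)[OF e]] by auto
    have prk: "pr (k e) = e" if e: "e \<in> lower_covers ?D d" for e
    proof (rule ccontr)
      assume ne: "pr (k e) \<noteq> e"
      note e' = lt[OF e] and ke = low[OF k(1)[OF e]]
      have in_D: "pr (k e) \<in> D" using prD ck e ke by blast
      have "e \<sqsubseteq> pr (k e)" using pr_greatest ke ck e e' by blast
      moreover have "pr (k e) \<sqsubseteq> d" using pr_mono[OF ke(1) j(1) ke(2)] clos_D[OF dD] by simp
      moreover have "pr (k e) \<noteq> d"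
      proof
        assume "pr (k e) = d"
        then have "d \<sqsubseteq> k e" using pr(2)[OF ke(1)] by simp
        then have "?j \<sqsubseteq> k e" using join_le[OF ck(1)[OF e] _ c(1) d(2) ke(1)] by blast
        then show False using le_antisym[OF ke(2) _ ke(1) j(1)] ke(3) by blast
      qed
      ultimately show False
        using e in_D ne by (auto simp: lower_covers_def lless_def eq_is_equal)
    qed
    have "d \<noteq> ?j" using down[OF d(1) c(1)] c(2) j(2) by auto
    then obtain w where w: "w \<in> lower_covers L ?j" "d \<sqsubseteq> w"
      using lower_cover_above[OF po fin d(2) j(1,3)] by blast
    \<comment> \<open>the additional lower cover, which accounts for the lost dimension\<close>
    have ncw: "\<not> c \<sqsubseteq> w"
    proof
      assume "c \<sqsubseteq> w"
      then have "?j \<sqsubseteq> w" using join_le[OF _ w(2) c(1) d(2) low(1)[OF w(1)]] by blast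
      then show False using le_antisym[OF low(2)[OF w(1)] _ low(1)[OF w(1)] j(1)] low(3)[OF w(1)] by blast
    qed
    have finj: "finite (lower_covers L ?j)"
      using fin j unfolding lower_finite_def lower_covers_def lless_def
      by (auto elim!: rev_finite_subset ballE[of _ _ ?j])
    have inj: "inj_on k (lower_covers ?D d)" by (metis inj_onI prk)
    have img: "insert w (k ` lower_covers ?D d) \<subseteq> lower_covers L ?j" using w k by auto
    moreover have "w \<notin> k ` lower_covers ?D d" using ck ncw by auto
    moreover have "finite (k ` lower_covers ?D d)" using finite_subset[OF img finj] by simp
    ultimately have "Suc (card (lower_covers ?D d)) \<le> card (lower_covers L ?j)"
      using card_mono[OF finj img] card_image[OF inj] by simp
    moreover have "card (lower_covers L ?j) \<le> Suc n" using L j by (simp add: ladder_def)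
    ultimately show ?thesis by linarith
  qed
  then have "ladder n ?D" using latD finD by (simp add: ladder_def)
  then show thesis
  proof (rule that[OF DI])
    show "\<exists>d\<in>D. p \<sqsubseteq> d \<and> (\<forall>e\<in>D. p \<sqsubseteq> e \<longrightarrow> d \<sqsubseteq> e)" if "p \<in> I" for p
      using clos[OF that] clos_least[OF that] by blast
    show "\<exists>d\<in>D. d \<sqsubseteq> y \<and> (\<forall>p\<in>I. p \<sqsubseteq> y \<longrightarrow> p \<sqsubseteq> d)" if "y \<in> carrier L" "c \<sqsubseteq> y" for y
      using prD[OF that] pr[OF that(1)] pr_greatest[OF that(1)] by blast
  qed
qed

section \<open>Coherent systems and their ladders\<close>

text \<open>
  The conditions on the pair \<open>(Sa, ga)\<close> that \<open>S\<close> and \<open>g\<close> take at \<open>a\<close>, given their values below \<open>a\<close>. They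
  are separated from \<open>S a\<close> and \<open>g a\<close> so that the recursion can choose the pair. The coherence of the
  sets is the one of the classical functions \<open>\<rho> : [\<omega>\<^sub>1]\<^sup>2 \<rightarrow> \<omega>\<close> with
  \<open>\<rho>(\<xi>, \<gamma>) \<le> max (\<rho>(\<xi>, \<beta>)) (\<rho>(\<beta>, \<gamma>))\<close> and \<open>\<rho>(\<xi>, \<beta>) \<le> max (\<rho>(\<xi>, \<gamma>)) (\<rho>(\<beta>, \<gamma>))\<close> for
  \<open>\<xi> < \<beta> < \<gamma>\<close>, where \<open>S \<alpha> m\<close> stands for \<open>{\<xi>. \<rho>(\<xi>, \<alpha>) \<le> m}\<close>. The last condition says that a triple
  \<open>(n, a, m)\<close> of the ladder stays in it when \<open>a\<close> is replaced by an element of \<open>Sa m\<close>; this is what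
  lower covers and meets need.
\<close>

definition coherent_at ::
  "'w rel \<Rightarrow> 'w \<Rightarrow> ('w \<Rightarrow> nat \<Rightarrow> 'w set) \<Rightarrow> ('w \<Rightarrow> nat \<Rightarrow> nat) \<Rightarrow> 'w \<Rightarrow> (nat \<Rightarrow> 'w set) \<Rightarrow> (nat \<Rightarrow> nat) \<Rightarrow> bool"
  where "coherent_at r z S g a Sa ga \<longleftrightarrow>
    (\<forall>m. finite (Sa m) \<and> a \<in> Sa m \<and> z \<in> Sa m \<and> Sa m \<subseteq> under r a) \<and>
    mono Sa \<and> (\<forall>b\<in>under r a. \<exists>m. b \<in> Sa m) \<and> mono ga \<and>
    (\<forall>m. \<forall>b\<in>Sa m \<inter> underS r a. S b m = Sa m \<inter> under r b \<and> (\<forall>n. ga n \<le> m \<longrightarrow> g b n \<le> m))"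

lemma coherent_atD:
  assumes coh: "coherent_at r z S g a (S a) (g a)"
  shows "finite (S a m)" and "a \<in> S a m" and "z \<in> S a m"
    and "b \<in> S a m \<Longrightarrow> (b, a) \<in> r"
    and "b \<in> S a l \<Longrightarrow> l \<le> m \<Longrightarrow> b \<in> S a m"
    and "(b, a) \<in> r \<Longrightarrow> \<exists>m. b \<in> S a m"
    and "n \<le> k \<Longrightarrow> g a n \<le> g a k"
    and "b \<in> S a m \<Longrightarrow> c \<in> S b m \<longleftrightarrow> c \<in> S a m \<and> (c, b) \<in> r"
    and "b \<in> S a m \<Longrightarrow> g a n \<le> m \<Longrightarrow> g b n \<le> m"
proof -
  show "finite (S a m)" "a \<in> S a m" "z \<in> S a m"
    and le: "b \<in> S a m \<Longrightarrow> (b, a) \<in> r" for b m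
    using coh by (auto simp: coherent_at_def under_def)
  show "b \<in> S a l \<Longrightarrow> l \<le> m \<Longrightarrow> b \<in> S a m" "(b, a) \<in> r \<Longrightarrow> \<exists>m. b \<in> S a m"
    "n \<le> k \<Longrightarrow> g a n \<le> g a k"
    using coh by (auto simp: coherent_at_def under_def dest: monoD)
  assume b: "b \<in> S a m"
  have "S b m = S a m \<inter> under r b \<and> (\<forall>n. g a n \<le> m \<longrightarrow> g b n \<le> m)"
  proof (cases "b = a")
    case True
    then show ?thesis using le by (auto simp: under_def)
  next
    case False
    then have "b \<in> S a m \<inter> underS r a" using le[OF b] b by (simp add: underS_def)
    then show ?thesis using coh unfolding coherent_at_def by blast
  qed
  then show "c \<in> S b m \<longleftrightarrow> c \<in> S a m \<and> (c, b) \<in> r" "g a n \<le> m \<Longrightarrow> g b n \<le> m"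
    by (auto simp: under_def)
qed

lemma Well_orderD:
  assumes "Well_order r"
  shows "a \<in> Field r \<Longrightarrow> (a, a) \<in> r"
    and "(a, b) \<in> r \<Longrightarrow> (b, c) \<in> r \<Longrightarrow> (a, c) \<in> r"
    and "(a, b) \<in> r \<Longrightarrow> (b, a) \<in> r \<Longrightarrow> a = b"
    and "a \<in> Field r \<Longrightarrow> b \<in> Field r \<Longrightarrow> (a, b) \<in> r \<or> (b, a) \<in> r"
proof -
  have "Refl r" "trans r" "antisym r" "Total r"
    using assms by (auto simp: order_on_defs)
  then show "a \<in> Field r \<Longrightarrow> (a, a) \<in> r"
    and "(a, b) \<in> r \<Longrightarrow> (b, c) \<in> r \<Longrightarrow> (a, c) \<in> r"
    and "(a, b) \<in> r \<Longrightarrow> (b, a) \<in> r \<Longrightarrow> a = b"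
    and "a \<in> Field r \<Longrightarrow> b \<in> Field r \<Longrightarrow> (a, b) \<in> r \<or> (b, a) \<in> r"
    by (auto simp: refl_on_def total_on_def dest: transD antisymD) metis
qed

locale coherent_system =
  fixes r :: "'w rel" and z :: 'w and S :: "'w \<Rightarrow> nat \<Rightarrow> 'w set" and g :: "'w \<Rightarrow> nat \<Rightarrow> nat"
  assumes wo: "Well_order r" and z: "z \<in> Field r"
    and coherent: "a \<in> Field r \<Longrightarrow> coherent_at r z S g a (S a) (g a)"
begin

lemmas r_refl = Well_orderD(1)[OF wo]
  and r_trans = Well_orderD(2)[OF wo]
  and r_antisym = Well_orderD(3)[OF wo]
  and r_total = Well_orderD(4)[OF wo]

lemma r_Field: "(a, b) \<in> r \<Longrightarrow> a \<in> Field r" "(a, b) \<in> r \<Longrightarrow> b \<in> Field r"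
  by (auto simp: Field_def)

lemmas S_finite = coherent_atD(1)[OF coherent]
  and S_self = coherent_atD(2)[OF coherent]
  and S_zero = coherent_atD(3)[OF coherent]
  and S_le = coherent_atD(4)[OF coherent]
  and S_mono = coherent_atD(5)[OF coherent]
  and S_cover = coherent_atD(6)[OF coherent[OF r_Field(2)]]
  and g_mono = coherent_atD(7)[OF coherent]
  and S_coherent = coherent_atD(8)[OF coherent]
  and g_coherent = coherent_atD(9)[OF coherent]

lemma S_Field: "a \<in> Field r \<Longrightarrow> b \<in> S a m \<Longrightarrow> b \<in> Field r"
  using S_le r_Field(1) by blast

lemma S_trans:
  assumes "a \<in> Field r" "b \<in> S a m" "c \<in> S b l" "l \<le> m"
  shows "c \<in> S a m"
  using assms S_coherent S_mono S_Field by blast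

lemma finite_greatest:
  assumes "finite X" "X \<noteq> {}" "X \<subseteq> Field r"
  obtains x where "x \<in> X" "\<And>y. y \<in> X \<Longrightarrow> (y, x) \<in> r"
proof -
  have "\<exists>x\<in>X. \<forall>y\<in>X. (y, x) \<in> r"
  proof (rule finite_subset_bounded[where R = "\<lambda>x y. (x, y) \<in> r"])
    show "\<exists>c\<in>X. (a, c) \<in> r \<and> (b, c) \<in> r" if "a \<in> X" "b \<in> X" for a b
      using r_total[of a b] r_refl that assms(3) by blast
  qed (use assms r_trans in auto)
  then show thesis using that by blast
qed

definition triples :: "(nat \<times> 'w \<times> nat) gorder"
  where "triples = \<lparr>carrier = {(n, a, m). a \<in> Field r \<and> g a n \<le> m}, eq = (=),
    le = (\<lambda>(n, a, l) (k, b, m). n \<le> k \<and> l \<le> m \<and> a \<in> S b m)\<rparr>"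

lemma triples_carrier [simp]: "(n, a, m) \<in> carrier triples \<longleftrightarrow> a \<in> Field r \<and> g a n \<le> m"
  and triples_le [simp]: "(n, a, l) \<sqsubseteq>\<^bsub>triples\<^esub> (k, b, m) \<longleftrightarrow> n \<le> k \<and> l \<le> m \<and> a \<in> S b m"
  and triples_eq [simp]: "eq triples = (=)"
  by (simp_all add: triples_def)

lemma triples_lless [simp]: "p \<sqsubset>\<^bsub>triples\<^esub> q \<longleftrightarrow> p \<sqsubseteq>\<^bsub>triples\<^esub> q \<and> p \<noteq> q"
  by (simp add: lless_def)

lemma triples_partial_order: "partial_order triples"
  unfolding partial_order_iff
proof (intro conjI ballI impI)
  fix p q s assume c: "p \<in> carrier triples" "q \<in> carrier triples" "s \<in> carrier triples"
  obtain n a l k b m j c i where pq: "p = (n, a, l)" "q = (k, b, m)" "s = (j, c, i)"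
    using prod_cases3 by metis
  show "p \<sqsubseteq>\<^bsub>triples\<^esub> p" using c pq S_self by simp
  show "p = q" if "p \<sqsubseteq>\<^bsub>triples\<^esub> q \<and> q \<sqsubseteq>\<^bsub>triples\<^esub> p"
    using that c S_le r_antisym unfolding pq by auto
  show "p \<sqsubseteq>\<^bsub>triples\<^esub> s" if "p \<sqsubseteq>\<^bsub>triples\<^esub> q \<and> q \<sqsubseteq>\<^bsub>triples\<^esub> s"
    using that c S_trans[of c b i a m] unfolding pq by auto
qed simp

lemma triples_lower_finite: "lower_finite triples"
  unfolding lower_finite_def
proof (intro ballI)
  fix p assume p: "p \<in> carrier triples"
  obtain n a m where pn: "p = (n, a, m)" by (cases p)
  have "{q \<in> carrier triples. q \<sqsubseteq>\<^bsub>triples\<^esub> p} \<subseteq> {..n} \<times> S a m \<times> {..m}"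
    by (auto simp: pn)
  moreover have "finite ({..n} \<times> S a m \<times> {..m})" using S_finite p by (simp add: pn)
  ultimately show "finite {q \<in> carrier triples. q \<sqsubseteq>\<^bsub>triples\<^esub> p}" by (rule finite_subset)
qed

lemma triples_directed:
  assumes p: "p \<in> carrier triples" and q: "q \<in> carrier triples"
  shows "\<exists>s\<in>carrier triples. p \<sqsubseteq>\<^bsub>triples\<^esub> s \<and> q \<sqsubseteq>\<^bsub>triples\<^esub> s"
proof -
  obtain n a l k b m where pq: "p = (n, a, l)" "q = (k, b, m)" by (cases p, cases q)
  have ab: "a \<in> Field r" "b \<in> Field r" using p q by (auto simp: pq)
  then obtain c where c: "c \<in> Field r" "(a, c) \<in> r" "(b, c) \<in> r"
    using r_total r_refl by blast
  obtain i j where "a \<in> S c i" "b \<in> S c j" using S_cover[OF c(2) c(2)] S_cover[OF c(3) c(3)] by blast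
  then have "a \<in> S c (i + j + l + m + g c (max n k))" "b \<in> S c (i + j + l + m + g c (max n k))"
    using S_mono[OF c(1)] by (meson le_add1 le_add2 le_trans)+
  then show ?thesis
    using c by (intro bexI[of _ "(max n k, c, i + j + l + m + g c (max n k))"]) (auto simp: pq)
qed

text \<open>
  Coordinatewise, with the greatest element of \<open>S a l \<inter> S b m\<close> as the meet of \<open>(a, l)\<close> and \<open>(b, m)\<close>.
  Every other element of the intersection is below it at level \<open>l\<close> and at level \<open>m\<close> by
  coherence, and the bound on the third coordinate is inherited.
\<close>

lemma triples_meet:
  assumes p: "p \<in> carrier triples" and q: "q \<in> carrier triples"
  shows "\<exists>s\<in>carrier triples. s \<sqsubseteq>\<^bsub>triples\<^esub> p \<and> s \<sqsubseteq>\<^bsub>triples\<^esub> q \<and>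
    (\<forall>u\<in>carrier triples. u \<sqsubseteq>\<^bsub>triples\<^esub> p \<and> u \<sqsubseteq>\<^bsub>triples\<^esub> q \<longrightarrow> u \<sqsubseteq>\<^bsub>triples\<^esub> s)"
proof -
  obtain n a l k b m where pq: "p = (n, a, l)" "q = (k, b, m)" by (cases p, cases q)
  have ab: "a \<in> Field r" "b \<in> Field r" and g: "g a n \<le> l" "g b k \<le> m" using p q by (auto simp: pq)
  obtain c where c: "c \<in> S a l" "c \<in> S b m" and max: "\<And>d. d \<in> S a l \<Longrightarrow> d \<in> S b m \<Longrightarrow> (d, c) \<in> r"
  proof (rule finite_greatest[of "S a l \<inter> S b m"])
    show "finite (S a l \<inter> S b m)" "S a l \<inter> S b m \<noteq> {}" "S a l \<inter> S b m \<subseteq> Field r"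
      using S_finite S_zero S_Field ab by blast+
  qed auto
  have cF: "c \<in> Field r" using S_Field c ab by blast
  have "g c (min n k) \<le> g c n" "g c (min n k) \<le> g c k" using g_mono cF by auto
  then have "g c (min n k) \<le> min l m"
    using g_coherent[OF ab(1) c(1) g(1)] g_coherent[OF ab(2) c(2) g(2)] by linarith
  moreover have "d \<in> S c (min l m)" if "d \<in> S a l" "d \<in> S b m" for d
    using S_coherent[OF ab(1) c(1)] S_coherent[OF ab(2) c(2)] max that
    by (cases "l \<le> m") (auto simp: min_def)
  ultimately show ?thesis
    using c cF S_mono[OF ab(1)] S_mono[OF ab(2)]
    by (intro bexI[of _ "(min n k, c, min l m)"]) (auto simp: pq)
qed

text \<open>
  A lower cover of \<open>(n, a, m)\<close> decreases exactly one coordinate, and each in only one way: \<open>n\<close> and \<open>m\<close>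
  by one, and \<open>a\<close> to the largest element of \<open>S a m\<close> other than \<open>a\<close>.
\<close>

lemma triples_lower_covers:
  assumes p: "p \<in> carrier triples"
  shows "card (lower_covers triples p) \<le> 3"
proof -
  obtain n a m where pn: "p = (n, a, m)" by (cases p)
  have a: "a \<in> Field r" and g: "g a n \<le> m" using p by (auto simp: pn)
  obtain c where c: "\<And>b. b \<in> S a m \<Longrightarrow> b \<noteq> a \<Longrightarrow> c \<in> S a m \<and> c \<noteq> a \<and> (b, c) \<in> r"
  proof (cases "S a m - {a} = {}")
    case True
    then show ?thesis using that by blast
  next
    case False
    have "finite (S a m - {a})" "S a m - {a} \<subseteq> Field r" using S_finite S_Field a by auto
    then obtain c where "c \<in> S a m - {a}" "\<And>b. b \<in> S a m - {a} \<Longrightarrow> (b, c) \<in> r"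
      using finite_greatest False by metis
    then show ?thesis using that[of c] by blast
  qed
  let ?T = "{(n - 1, a, m), (n, c, m), (n, a, m - 1)}"
  have "q \<in> ?T" if q: "q \<in> lower_covers triples p" for q
  proof (rule ccontr)
    assume nT: "q \<notin> ?T"
    obtain k b l where qk: "q = (k, b, l)" by (cases q)
    have le: "k \<le> n" "l \<le> m" "b \<in> S a m" "q \<noteq> p" and qc: "b \<in> Field r" "g b k \<le> l"
      using q by (auto simp: lower_covers_def pn qk)
    have nb: False if "x \<in> carrier triples" "q \<sqsubseteq>\<^bsub>triples\<^esub> x" "q \<noteq> x" "x \<sqsubseteq>\<^bsub>triples\<^esub> p" "x \<noteq> p" for x
      using q that unfolding lower_covers_def triples_lless by blast
    consider "k < n" | "k = n" "b \<noteq> a" | "k = n" "b = a" "l < m"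
      using le by (fastforce simp: pn qk le_less)
    then show False
    proof cases
      case 1
      have "g a (n - 1) \<le> m" using g_mono[OF a, of "n - 1" n] g by simp
      then show False
        using 1 nT le a S_self[OF a] by (intro nb[of "(n - 1, a, m)"]) (auto simp: pn qk)
    next
      case 2
      note c' = c[OF le(3) 2(2)]
      have "c \<in> Field r" "g c n \<le> m" using c' a S_Field g_coherent g by blast+
      moreover have "b \<in> S c m" using S_coherent[OF a] c' le by blast
      ultimately show False
        using 2 nT le c' by (intro nb[of "(n, c, m)"]) (auto simp: pn qk)
    next
      case 3
      then show False
        using nT qc S_self[OF a] by (intro nb[of "(n, a, m - 1)"]) (auto simp: pn qk)
    qed
  qed
  then have "card (lower_covers triples p) \<le> card ?T" by (intro card_mono) auto
  also have "\<dots> \<le> 3" by (auto simp: card_insert_if)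
  finally show ?thesis .
qed

theorem triples_ladder: "ladder 3 triples"
  using lattice_of_meets[OF triples_partial_order triples_lower_finite triples_directed triples_meet]
    triples_lower_finite triples_lower_covers
  by (simp add: ladder_def)

text \<open>
  Two descents lead to a chain \<open>D\<close> whose image in the first and third coordinates is bounded by a
  function \<open>f\<close>, whereas the element \<open>y\<close> of the intermediate \<open>2\<close>-ladder \<open>C\<close> shares these coordinates
  with an element of \<open>D\<close>, although they lie on or above the graph of some \<open>g b\<close> that dominates \<open>f\<close>.
\<close>

theorem no_proper_extension:
  fixes L (structure)
  assumes L: "ladder 3 L" and I: "proper_order_ideal L I"
    and h: "bij_betw h (carrier triples) I"
    and h_le: "\<And>p q. p \<in> carrier triples \<Longrightarrow> q \<in> carrier triples \<Longrightarrow> h p \<sqsubseteq> h q \<longleftrightarrow> p \<sqsubseteq>\<^bsub>triples\<^esub> q"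
    and unc: "uncountable (Field r)"
    and dom: "\<And>f :: nat \<Rightarrow> nat. \<exists>a\<in>Field r. \<forall>\<^sub>\<infinity>k. f k < g a k"
  shows False
proof -
  have Iid: "order_ideal L I" and IL: "I \<subseteq> carrier L" "I \<noteq> carrier L"
    using I by (auto simp: proper_order_ideal_def order_ideal_def)
  interpret L: lattice L using L by (simp add: ladder_def)
  obtain x where x: "x \<in> carrier L" "x \<notin> I" using IL by blast
  have L': "ladder (Suc 2) L" using L by (simp add: numeral_3_eq_3)
  obtain C where C: "C \<subseteq> I" "ladder 2 (L\<lparr>carrier := C\<rparr>)"
    and clC: "\<And>p. p \<in> I \<Longrightarrow> \<exists>d\<in>C. p \<sqsubseteq> d \<and> (\<forall>e\<in>C. p \<sqsubseteq> e \<longrightarrow> d \<sqsubseteq> e)"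
    using ladder_descent[OF L' Iid x] by metis
  have hI: "h p \<in> I" if "p \<in> carrier triples" for p using h that by (auto simp: bij_betw_def)
  have hsurj: "\<exists>n a m. i = h (n, a, m) \<and> a \<in> Field r \<and> g a n \<le> m" if "i \<in> I" for i
    using h that by (force simp: bij_betw_def triples_def)
  obtain cl where cl: "\<And>p. p \<in> carrier triples \<Longrightarrow> cl p \<in> C"
    "\<And>p. p \<in> carrier triples \<Longrightarrow> h p \<sqsubseteq> cl p"
    and cl_least: "\<And>p e. p \<in> carrier triples \<Longrightarrow> e \<in> C \<Longrightarrow> h p \<sqsubseteq> e \<Longrightarrow> cl p \<sqsubseteq> e"
  proof -
    have "\<forall>p\<in>carrier triples. \<exists>d. d \<in> C \<and> h p \<sqsubseteq> d \<and> (\<forall>e\<in>C. h p \<sqsubseteq> e \<longrightarrow> d \<sqsubseteq> e)"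
      using clC hI by blast
    from bchoice[OF this] show thesis using that by blast
  qed
  let ?M = "L\<lparr>carrier := C\<rparr>"
  interpret M: lattice ?M using C(2) by (simp add: ladder_def)
  have car: "e \<in> carrier L" if "e \<in> C" for e using that C IL by blast
  have car_h: "h p \<in> carrier L" if "p \<in> carrier triples" for p using hI[OF that] IL by blast
  have trans: "u \<sqsubseteq> w" if "u \<sqsubseteq> v" "v \<sqsubseteq> w" "u \<in> carrier L" "v \<in> carrier L" "w \<in> carrier L" for u v w
    using L.le_trans that by blast
  have unc_C: "uncountable C"
  proof
    assume cC: "countable C"
    have fin: "finite {q \<in> carrier L. q \<sqsubseteq> e}" if "e \<in> C" for e
      using L car[OF that] by (simp add: ladder_def lower_finite_def)
    have "(\<lambda>a. h (0, a, g a 0)) ` Field r \<subseteq> (\<Union>e\<in>C. {q \<in> carrier L. q \<sqsubseteq> e})"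
    proof (rule image_subsetI)
      fix a assume "a \<in> Field r"
      then have "(0, a, g a 0) \<in> carrier triples" by simp
      from cl[OF this] car_h[OF this]
      show "h (0, a, g a 0) \<in> (\<Union>e\<in>C. {q \<in> carrier L. q \<sqsubseteq> e})" by blast
    qed
    moreover have "countable (\<Union>e\<in>C. {q \<in> carrier L. q \<sqsubseteq> e})"
      by (intro countable_UN[OF cC] countable_finite[OF fin])
    ultimately have "countable ((\<lambda>a. h (0, a, g a 0)) ` Field r)" by (rule countable_subset)
    moreover have "inj_on (\<lambda>a. h (0, a, g a 0)) (Field r)"
    proof (rule inj_onI)
      fix a b assume ab: "a \<in> Field r" "b \<in> Field r" and eq: "h (0, a, g a 0) = h (0, b, g b 0)"
      have "inj_on h (carrier triples)" using h by (simp add: bij_betw_def)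
      from inj_onD[OF this eq] ab show "a = b" by simp
    qed
    ultimately show False using countable_image_inj_on unc by blast
  qed
  \<comment> \<open>\<open>J\<close> has to contain these closures, so that shadows in \<open>J\<close> preserve the outer coordinates\<close>
  let ?S = "cl ` {(n, z, m) | n m. g z n \<le> m}"
  have S: "?S \<subseteq> carrier ?M" using cl z by auto
  have "?S \<noteq> {}" by blast
  moreover have "countable ?S"
  proof -
    have "{(n, z, m) | n m. g z n \<le> m} \<subseteq> range (\<lambda>(n, m). (n, z, m))" by auto
    then show ?thesis by (meson countable_image countable_subset countableI_type)
  qed
  ultimately obtain J where J: "order_ideal ?M J" "countable J" "?S \<subseteq> J"
    using countable_order_ideal[OF C(2) S] by blast
  have JC: "J \<subseteq> C" using J(1) by (simp add: order_ideal_def)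
  obtain c where c: "c \<in> C" "c \<notin> J" using unc_C J(2) JC by (metis countable_subset subsetI)
  have clJ: "cl (n, z, m) \<in> J" if "g z n \<le> m" for n m using J(3) that by blast
  have M': "ladder (Suc 1) ?M" using C(2) by (simp add: numeral_2_eq_2)
  obtain D where D: "D \<subseteq> J" "ladder 1 (L\<lparr>carrier := D\<rparr>)"
    and D_cofinal: "\<And>p. p \<in> J \<Longrightarrow> \<exists>d\<in>D. p \<sqsubseteq> d"
    and D_proj: "\<And>y. y \<in> C \<Longrightarrow> c \<sqsubseteq> y \<Longrightarrow> \<exists>d\<in>D. d \<sqsubseteq> y \<and> (\<forall>p\<in>J. p \<sqsubseteq> y \<longrightarrow> p \<sqsubseteq> d)"
  proof (rule ladder_descent[OF M' J(1), of c])
    fix D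
    assume "D \<subseteq> J" "ladder 1 (?M\<lparr>carrier := D\<rparr>)"
      "\<And>p. p \<in> J \<Longrightarrow> \<exists>d\<in>D. p \<sqsubseteq>\<^bsub>?M\<^esub> d \<and> (\<forall>e\<in>D. p \<sqsubseteq>\<^bsub>?M\<^esub> e \<longrightarrow> d \<sqsubseteq>\<^bsub>?M\<^esub> e)"
      "\<And>y. y \<in> carrier ?M \<Longrightarrow> c \<sqsubseteq>\<^bsub>?M\<^esub> y \<Longrightarrow>
        \<exists>d\<in>D. d \<sqsubseteq>\<^bsub>?M\<^esub> y \<and> (\<forall>p\<in>J. p \<sqsubseteq>\<^bsub>?M\<^esub> y \<longrightarrow> p \<sqsubseteq>\<^bsub>?M\<^esub> d)"
    then show thesis by (intro that[of D]) (simp, simp, simp, blast, simp)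
  qed (use c in auto)
  have DI: "D \<subseteq> I" using D JC C by blast
  have chain: "d \<sqsubseteq> e \<or> e \<sqsubseteq> d" if "d \<in> D" "e \<in> D" for d e
    using ladder_1_chain[OF D(2), of d e] that by simp
  \<comment> \<open>an element of the chain with first coordinate \<open>n\<close> lies below one whose first coordinate is larger\<close>
  have "\<exists>b. \<forall>a m. a \<in> Field r \<and> g a n \<le> m \<and> h (n, a, m) \<in> D \<longrightarrow> m \<le> b" for n
  proof -
    let ?p = "(Suc n, z, g z (Suc n))"
    have p: "?p \<in> carrier triples" using z by simp
    obtain d where d: "d \<in> D" "cl ?p \<sqsubseteq> d" using D_cofinal clJ[of "Suc n"] by blast
    obtain k b l where dk: "d = h (k, b, l)" and b: "b \<in> Field r" "g b k \<le> l"
      using hsurj d(1) DI by blast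
    have "h ?p \<sqsubseteq> d"
      using trans[OF cl(2)[OF p] d(2)] car_h[OF p] car[OF cl(1)[OF p]] d(1) DI IL by blast
    then have "n < k" using b p h_le[of ?p "(k, b, l)"] by (simp add: dk)
    have "m \<le> l" if a: "a \<in> Field r" "g a n \<le> m" "h (n, a, m) \<in> D" for a m
      using chain[OF a(3) d(1)] \<open>n < k\<close> a b h_le[of "(n, a, m)" "(k, b, l)"]
        h_le[of "(k, b, l)" "(n, a, m)"] by (auto simp: dk)
    then show ?thesis by blast
  qed
  then obtain f where f: "\<And>n a m. a \<in> Field r \<Longrightarrow> g a n \<le> m \<Longrightarrow> h (n, a, m) \<in> D \<Longrightarrow> m \<le> f n"
    by metis
  obtain b where b: "b \<in> Field r" "\<forall>\<^sub>\<infinity>k. f k < g b k" using dom by blast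
  then obtain N where N: "\<And>k. k \<ge> N \<Longrightarrow> f k < g b k" by (auto simp: MOST_nat_le)
  let ?p = "(N, b, g b N)"
  have p: "?p \<in> carrier triples" using b by simp
  obtain y where y: "y \<in> C" "c \<sqsubseteq> y" "cl ?p \<sqsubseteq> y"
    using M.join_closed[of c "cl ?p"] M.join_left[of c "cl ?p"] M.join_right[of c "cl ?p"] c cl(1)[OF p]
    by auto
  obtain n a m where yn: "y = h (n, a, m)" and a: "a \<in> Field r" "g a n \<le> m"
    using hsurj y(1) C by blast
  have yt: "(n, a, m) \<in> carrier triples" using a by simp
  have "h ?p \<sqsubseteq> h (n, a, m)"
    using trans[OF cl(2)[OF p] y(3)] car_h[OF p] car[OF cl(1)[OF p]] car[OF y(1)] by (simp add: yn)
  then have Nn: "N \<le> n" "b \<in> S a m" using h_le[OF p yt] by auto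
  have gz: "g z n \<le> m" using g_coherent[OF a(1) S_zero[OF a(1)] a(2)] .
  \<comment> \<open>the shadow \<open>d\<close> of \<open>y\<close> lies between \<open>(n, z, m)\<close> and \<open>y\<close>\<close>
  let ?q = "(n, z, m)"
  have q: "?q \<in> carrier triples" using z gz by simp
  have "h ?q \<sqsubseteq> y" using h_le[OF q yt] S_zero[OF a(1)] by (simp add: yn)
  then have clq: "cl ?q \<sqsubseteq> y" using cl_least[OF q y(1)] by blast
  obtain d where d: "d \<in> D" "d \<sqsubseteq> y" "cl ?q \<sqsubseteq> d" using D_proj[OF y(1,2)] clJ[OF gz] clq by blast
  obtain k e l where dk: "d = h (k, e, l)" and e: "e \<in> Field r" "g e k \<le> l"
    using hsurj d(1) DI by blast
  have dt: "(k, e, l) \<in> carrier triples" using e by simp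
  have "h ?q \<sqsubseteq> d"
    using trans[OF cl(2)[OF q] d(3)] car_h[OF q] car[OF cl(1)[OF q]] d(1) DI IL by blast
  then have "k = n \<and> l = m"
    using h_le[OF q dt] h_le[OF dt yt] d(2) by (simp add: dk yn)
  then have "m \<le> f n" using f e d(1) dk by blast
  also have "f n < g b n" using N Nn by blast
  also have "g b n \<le> m" using g_coherent[OF a(1) Nn(2) a(2)] .
  finally show False by simp
qed

end

section \<open>Existence of coherent systems\<close>

text \<open>
  Unless \<open>a = z\<close>, choose a nondecreasing sequence \<open>x\<close> that starts at \<open>z\<close> and is cofinal below
  \<open>a\<close>, and put \<open>a\<close> above \<open>x k\<close> from level \<open>t k\<close> onwards: \<open>Sa m\<close> consists of \<open>a\<close> and of all \<open>S (x k) m\<close> with \<open>t k \<le> m\<close>. If \<open>t\<close>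
  grows fast enough, then \<open>x k \<in> S (x (k + 1)) m\<close> for all \<open>m \<ge> t (k + 1)\<close>, so these sets form a chain
  of initial segments. Moreover \<open>g (x (k + 1)) (k + 1) \<le> t (k + 1)\<close>; thus any monotone \<open>ga\<close> with
  \<open>ga n \<ge> t (n + 1)\<close> meets the condition on \<open>g\<close>, however large it is, and \<open>F \<le> ga\<close> can be arranged.
\<close>

lemma coherent_extension:
  fixes S :: "'w \<Rightarrow> nat \<Rightarrow> 'w set" and g :: "'w \<Rightarrow> nat \<Rightarrow> nat"
  assumes wo: "Well_order r" and a: "a \<in> Field r"
    and cnt: "countable (underS r a)"
    and z: "\<And>b. b \<in> Field r \<Longrightarrow> (z, b) \<in> r"
    and below: "\<And>b. b \<in> underS r a \<Longrightarrow> coherent_at r z S g b (S b) (g b)"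
  shows "\<exists>Sa ga. coherent_at r z S g a Sa ga \<and> (\<forall>n. F n \<le> ga n)"
proof (cases "a = z")
  case True
  have no: "underS r a = {}"
    using z wo True by (auto simp: underS_def Field_def order_on_defs antisym_def)
  have "coherent_at r z S g a (\<lambda>m. {a}) (\<lambda>n. \<Sum>i\<le>n. F i)"
    unfolding coherent_at_def no using z[OF a] True no
    by (auto simp: mono_def under_def underS_def intro: sum_mono2)
  moreover have "\<forall>n. F n \<le> (\<Sum>i\<le>n. F i)"
    using member_le_sum[of _ _ F] by auto
  ultimately show ?thesis by blast
next
  case False
  let ?X = "underS r a"
  note refl = Well_orderD(1)[OF wo] and trans = Well_orderD(2)[OF wo]
    and antisym = Well_orderD(3)[OF wo] and total = Well_orderD(4)[OF wo]
  have XF: "b \<in> Field r" "(b, a) \<in> r" "b \<noteq> a" if "b \<in> ?X" for b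
    using that by (auto simp: underS_def Field_def)
  have X_down: "c \<in> ?X" if "b \<in> ?X" "(c, b) \<in> r" for b c
    using that trans[of c b a] antisym[of b c] by (auto simp: underS_def dest: antisym)
  have zX: "z \<in> ?X" using z[OF a] False by (simp add: underS_def)
  note Sfin = coherent_atD(1)[OF below] and Sself = coherent_atD(2)[OF below]
    and Szero = coherent_atD(3)[OF below] and Sle = coherent_atD(4)[OF below]
    and Smono = coherent_atD(5)[OF below] and Scover = coherent_atD(6)[OF below]
    and gmono = coherent_atD(7)[OF below] and Scoh = coherent_atD(8)[OF below]
    and gcoh = coherent_atD(9)[OF below]
  define e where "e = from_nat_into ?X"
  have eX: "e k \<in> ?X" for k using from_nat_into[of ?X k] zX by (auto simp: e_def)
  have e_surj: "\<exists>k. b = e k" if "b \<in> ?X" for b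
    using from_nat_into_surj[OF cnt that] by (auto simp: e_def)
  define x where "x = rec_nat z (\<lambda>k b. if (b, e k) \<in> r then e k else b)"
  have x_simps: "x 0 = z" "\<And>k. x (Suc k) = (if (x k, e k) \<in> r then e k else x k)"
    by (simp_all add: x_def)
  have xX: "x k \<in> ?X" for k by (induction k) (simp_all add: x_simps zX eX)
  have x_Suc: "(x k, x (Suc k)) \<in> r" and e_x: "(e k, x (Suc k)) \<in> r" for k
    using total[of "x k" "e k"] refl XF eX xX by (auto simp: x_simps)
  define p where "p k = (SOME m. x k \<in> S (x (Suc k)) m)" for k
  have p: "x k \<in> S (x (Suc k)) (p k)" for k
    unfolding p_def by (rule someI_ex[OF Scover[OF xX x_Suc]])
  \<comment> \<open>\<open>t 0 = 0\<close> puts \<open>z\<close> into every \<open>Sa m\<close>; strict growth keeps the sets finite\<close>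
  define t where "t = rec_nat 0 (\<lambda>k i. Suc (i + p k + g (x (Suc k)) (Suc k)))"
  have t_simps: "t 0 = 0" "\<And>k. t (Suc k) = Suc (t k + p k + g (x (Suc k)) (Suc k))"
    by (simp_all add: t_def)
  have t_mono: "strict_mono t" by (simp add: strict_mono_Suc_iff t_simps)
  have t_ge: "k \<le> t k" for k using t_mono by (rule strict_mono_imp_increasing)
  have g_t: "g (x (Suc k)) n \<le> t (Suc k)" if "n \<le> Suc k" for k n
    using gmono[OF xX that, of "Suc k"] by (simp add: t_simps)
  have chain: "x k \<in> S (x j) m" if "k \<le> j" "t j \<le> m" for k j m
    using that
  proof (induction j rule: dec_induct)
    case base
    then show ?case using Sself xX by blast
  next
    case (step j)
    have "x j \<in> S (x (Suc j)) m"
      using Smono[OF xX p] step.prems by (simp add: t_simps)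
    moreover have "x k \<in> S (x j) m" using step by (simp add: t_simps)
    ultimately show ?case using Scoh[OF xX] by blast
  qed
  have lift: "b \<in> S (x j) m" if "b \<in> S (x k) m" "k \<le> j" "t j \<le> m" for b k j m
    using Scoh[OF xX chain[OF that(2,3)]] that(1) by blast
  define Sa where "Sa m = insert a (\<Union>k\<in>{k. t k \<le> m}. S (x k) m)" for m
  \<comment> \<open>\<open>t (Suc n)\<close>, not \<open>t n\<close>, because \<open>t 0 = 0\<close> gives no bound on \<open>g (x 0)\<close>\<close>
  define ga where "ga n = t (Suc n) + (\<Sum>i\<le>n. F i)" for n
  have Sa_X: "\<exists>k. t k \<le> m \<and> b \<in> S (x k) m" if "b \<in> Sa m" "b \<noteq> a" for b m
    using that by (auto simp: Sa_def)
  have "coherent_at r z S g a Sa ga"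
    unfolding coherent_at_def
  proof (intro conjI allI ballI impI)
    fix m
    have "{k. t k \<le> m} \<subseteq> {..m}" using t_ge order_trans by fastforce
    then have "finite {k. t k \<le> m}" by (rule finite_subset) simp
    then show "finite (Sa m)" using Sfin xX by (simp add: Sa_def)
    show "a \<in> Sa m" by (simp add: Sa_def)
    have "z \<in> S (x 0) m" using Szero xX by blast
    then show "z \<in> Sa m" unfolding Sa_def using t_simps(1) by auto
    show "Sa m \<subseteq> under r a"
      using trans[OF Sle[OF xX] XF(2)[OF xX]] refl[OF a] by (auto simp: Sa_def under_def)
  next
    show "mono Sa"
      by (rule monoI) (use Smono[OF xX] in \<open>fastforce simp: Sa_def\<close>)
    show "mono ga"
      unfolding ga_def
      by (intro monoI add_mono sum_mono2) (use t_mono in \<open>auto simp: strict_mono_less_eq\<close>)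
  next
    fix b assume b: "b \<in> under r a"
    show "\<exists>m. b \<in> Sa m"
    proof (cases "b = a")
      case False
      then have bX: "b \<in> ?X" using b by (simp add: under_def underS_def)
      then obtain k where "b = e k" using e_surj by blast
      then obtain m where m: "b \<in> S (x (Suc k)) m" using Scover[OF xX] e_x by blast
      then have "b \<in> S (x (Suc k)) (m + t (Suc k))" using Smono[OF xX] by simp
      then have "b \<in> Sa (m + t (Suc k))" unfolding Sa_def using le_add2 by blast
      then show ?thesis by blast
    qed (simp add: Sa_def)
  next
    fix m b assume b: "b \<in> Sa m \<inter> underS r a"
    then obtain k where k: "t k \<le> m" "b \<in> S (x k) m" using Sa_X XF(3) by blast
    show "S b m = Sa m \<inter> under r b"
    proof (intro equalityI subsetI)
      fix c assume "c \<in> S b m"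
      then show "c \<in> Sa m \<inter> under r b"
        using Scoh[OF xX k(2)] k by (auto simp: Sa_def under_def)
    next
      fix c assume c: "c \<in> Sa m \<inter> under r b"
      then have "c \<in> ?X" using X_down b by (auto simp: under_def)
      then obtain j where j: "t j \<le> m" "c \<in> S (x j) m" using Sa_X c XF(3) by blast
      let ?l = "max j k"
      have l: "t ?l \<le> m" using j k by (simp add: max_def)
      have "c \<in> S (x ?l) m" "b \<in> S (x ?l) m"
        using lift[OF j(2) _ l] lift[OF k(2) _ l] by simp_all
      then show "c \<in> S b m" using Scoh[OF xX] c by (simp add: under_def)
    qed
    fix n assume "ga n \<le> m"
    then have n: "t (Suc n) \<le> m" by (simp add: ga_def)
    obtain l where l: "Suc l = max k (Suc n)" using that[of "max k (Suc n) - 1"] by simp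
    have tl: "t (Suc l) \<le> m" using k n by (simp add: l max_def)
    have "b \<in> S (x (Suc l)) m" using lift[OF k(2) _ tl] l by simp
    moreover have "g (x (Suc l)) n \<le> m" by (rule order_trans[OF g_t tl]) (simp add: l)
    ultimately show "g b n \<le> m" using gcoh[OF xX] by blast
  qed
  moreover have "F n \<le> ga n" for n
    using member_le_sum[of n "{..n}" F] by (simp add: ga_def)
  ultimately show ?thesis by blast
qed

theorem coherent_system_exists:
  fixes r :: "'w rel" and F :: "'w \<Rightarrow> nat \<Rightarrow> nat"
  assumes wo: "Well_order r" and ne: "Field r \<noteq> {}"
    and cnt: "\<And>a. a \<in> Field r \<Longrightarrow> countable (underS r a)"
  obtains z S g where "coherent_system r z S g" "\<And>a n. a \<in> Field r \<Longrightarrow> F a n \<le> g a n"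
proof -
  have wo_rel: "wo_rel r" using wo by (simp add: wo_rel_def)
  define z where "z = wo_rel.minim r (Field r)"
  have z: "z \<in> Field r" "\<And>b. b \<in> Field r \<Longrightarrow> (z, b) \<in> r"
    using wo_rel.minim_in[OF wo_rel subset_refl ne] wo_rel.minim_least[OF wo_rel subset_refl]
    by (auto simp: z_def)
  have wf: "wf (r - Id)" using wo by (simp add: well_order_on_def)
  let ?P = "\<lambda>H a v. a \<in> Field r \<longrightarrow>
    coherent_at r z (\<lambda>b. fst (H b)) (\<lambda>b. snd (H b)) a (fst v) (snd v) \<and> (\<forall>n. F a n \<le> snd v n)"
  have "\<exists>H. \<forall>a. ?P H a (H a)"
  proof (rule dependent_wf_choice[OF wf])
    fix H K :: "'w \<Rightarrow> (nat \<Rightarrow> 'w set) \<times> (nat \<Rightarrow> nat)" and a v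
    assume "\<And>b. (b, a) \<in> r - Id \<Longrightarrow> H b = K b"
    then have "H b = K b" if "b \<in> underS r a" for b using that by (simp add: underS_def)
    then show "?P H a v = ?P K a v" by (auto simp: coherent_at_def)
  next
    fix a and H :: "'w \<Rightarrow> (nat \<Rightarrow> 'w set) \<times> (nat \<Rightarrow> nat)"
    assume IH: "\<And>b. (b, a) \<in> r - Id \<Longrightarrow> ?P H b (H b)"
    show "\<exists>v. ?P H a v"
    proof (cases "a \<in> Field r")
      case True
      have "coherent_at r z (\<lambda>b. fst (H b)) (\<lambda>b. snd (H b)) b (fst (H b)) (snd (H b))"
        if "b \<in> underS r a" for b
        using IH[of b] that by (auto simp: underS_def Field_def)
      from coherent_extension[OF wo True cnt[OF True] z(2) this, of "F a"]
      show ?thesis by auto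
    qed simp
  qed
  then obtain H where H: "\<And>a. ?P H a (H a)" by blast
  have "coherent_system r z (\<lambda>b. fst (H b)) (\<lambda>b. snd (H b))"
    by unfold_locales (use wo z H in auto)
  then show thesis using that[of z "\<lambda>b. fst (H b)" "\<lambda>b. snd (H b)"] H by blast
qed

section \<open>A maximal ladder\<close>

theorem theorem2:
  assumes "dominating_number =o aleph1"
  shows "\<exists>P :: (nat \<Rightarrow> nat) gorder. maximal_ladder 3 P \<and> |carrier P| =o aleph1"
proof -
  obtain W where W: "dominating W" "dominating_number = |W|"
    using dominating_number_least(1) by blast
  have card_W: "|W| =o aleph1" using assms W by simp
  have Field_W: "Field |W| = W" by (rule Field_card_of)
  have "natLeq <o aleph1" by (rule cardSuc_greater[OF natLeq_Card_order])
  then have "natLeq <o |W|" by (rule ordLess_ordIso_trans[OF _ ordIso_symmetric[OF card_W]])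
  then have unc: "uncountable W"
    using countable_card_le_natLeq not_ordLess_ordLeq by blast
  have "countable (underS |W| a)" if "a \<in> W" for a
  proof -
    have "|underS |W| a| <o |W|"
      by (rule card_of_underS[OF card_of_Card_order]) (simp add: Field_W that)
    then have "|underS |W| a| <o aleph1" using card_W by (rule ordLess_ordIso_trans)
    then have "|underS |W| a| \<le>o natLeq"
      using cardSuc_ordLeq_ordLess[OF natLeq_Card_order card_of_Card_order] by blast
    then show ?thesis by (simp add: countable_card_le_natLeq)
  qed
  moreover have "W \<noteq> {}" using unc by auto
  ultimately obtain z S g where "coherent_system |W| z S g"
    and g: "\<And>a n. a \<in> W \<Longrightarrow> a n \<le> g a n"
    using coherent_system_exists[OF card_of_Well_order, of W "\<lambda>a. a"] unfolding Field_W by metis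
  then interpret coherent_system "|W|" z S g by blast
  \<comment> \<open>a triple becomes the sequence \<open>n, m, a 0, a 1, \<dots>\<close>\<close>
  define code :: "nat \<times> (nat \<Rightarrow> nat) \<times> nat \<Rightarrow> nat \<Rightarrow> nat"
    where "code = (\<lambda>(n, a, m). case_nat n (case_nat m a))"
  have "inj code"
  proof (rule injI)
    fix p q assume eq: "code p = code q"
    obtain n a m k b l where pq: "p = (n, a, m)" "q = (k, b, l)" by (cases p, cases q)
    have "code p 0 = code q 0" "code p (Suc 0) = code q (Suc 0)"
      "\<And>i. code p (Suc (Suc i)) = code q (Suc (Suc i))" using eq by simp_all
    then show "p = q" by (auto simp: pq code_def)
  qed
  define P :: "(nat \<Rightarrow> nat) gorder" where "P = \<lparr>carrier = code ` carrier triples, eq = (=),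
    le = (\<lambda>u v. inv code u \<sqsubseteq>\<^bsub>triples\<^esub> inv code v)\<rparr>"
  have P_le: "code p \<sqsubseteq>\<^bsub>P\<^esub> code q \<longleftrightarrow> p \<sqsubseteq>\<^bsub>triples\<^esub> q" for p q
    using \<open>inj code\<close> by (simp add: P_def)
  have bij: "bij_betw code (carrier triples) (carrier P)"
    using inj_on_subset[OF \<open>inj code\<close>] by (simp add: P_def bij_betw_def)
  have dom: "\<exists>a\<in>Field |W|. \<forall>\<^sub>\<infinity>k. f k < g a k" for f
  proof -
    obtain a where a: "a \<in> W" "\<forall>\<^sub>\<infinity>k. f k < a k"
      using W(1) unfolding dominating_def dominates_def by blast
    from a(2) have "\<forall>\<^sub>\<infinity>k. f k < g a k"
      by (rule MOST_mono) (use g[OF a(1)] order_less_le_trans in blast)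
    then show ?thesis using a Field_W by blast
  qed
  have "maximal_ladder 3 P"
    unfolding maximal_ladder_def
  proof (intro conjI notI)
    show "ladder 3 P"
      by (rule ladder_transport[OF triples_ladder bij]) (simp_all add: P_le, simp add: P_def)
    assume "\<exists>(L :: ((nat \<Rightarrow> nat) + nat) gorder) I.
      ladder 3 L \<and> proper_order_ideal L I \<and> order_isomorphic P (L\<lparr>carrier := I\<rparr>)"
    then obtain L :: "((nat \<Rightarrow> nat) + nat) gorder" and I f where L: "ladder 3 L" "proper_order_ideal L I"
      and f: "order_emb P (L\<lparr>carrier := I\<rparr>) f" "bij_betw f (carrier P) I"
      unfolding order_isomorphic_def by auto
    have "(f \<circ> code) p \<sqsubseteq>\<^bsub>L\<^esub> (f \<circ> code) q \<longleftrightarrow> p \<sqsubseteq>\<^bsub>triples\<^esub> q"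
      if "p \<in> carrier triples" "q \<in> carrier triples" for p q
      using f(1) that P_le[of p q] by (simp add: order_emb_simp P_def)
    from no_proper_extension[OF L bij_betw_trans[OF bij f(2)] this _ dom] unc
    show False by (simp add: Field_W)
  qed
  moreover have "|carrier P| =o aleph1"
  proof -
    have "|W| \<le>o |carrier triples|"
    proof (rule iffD1[OF card_of_ordLeq], intro exI conjI)
      show "inj_on (\<lambda>a. (0, a, g a 0)) W" by (simp add: inj_on_def)
      show "(\<lambda>a. (0, a, g a 0)) ` W \<subseteq> carrier triples" using Field_W by auto
    qed
    moreover have "|carrier triples| \<le>o |W|"
    proof -
      have inf: "\<not> finite W" using unc countable_finite by blast
      have "|UNIV :: nat set| \<le>o |W|" using inf by (simp add: infinite_iff_card_of_nat)
      then have "|W \<times> (UNIV :: nat set)| =o |W|" 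
        using card_of_Times_infinite[OF inf] by blast
      then have WN: "|W \<times> (UNIV :: nat set)| \<le>o |W|" by (rule ordIso_imp_ordLeq)
      have prod: "|(UNIV :: nat set) \<times> W \<times> (UNIV :: nat set)| \<le>o |W|"
        using card_of_Times_ordLeq_infinite_Field[of "|W|", unfolded Field_card_of,
            OF inf \<open>|UNIV :: nat set| \<le>o |W|\<close> WN card_of_card_order_on] .
      have "carrier triples \<subseteq> UNIV \<times> W \<times> UNIV" by (auto simp: triples_def Field_W)
      then show ?thesis by (rule ordLeq_transitive[OF card_of_mono1 prod])
    qed
    ultimately have "|carrier triples| =o |W|" by (simp only: ordIso_iff_ordLeq)
    from ordIso_transitive[OF this card_W]
    show ?thesis by (rule ordIso_transitive[OF ordIso_symmetric[OF card_of_ordIsoI[OF bij]]])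
  qed
  ultimately show ?thesis by blast
qed

end
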